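(* Let $(p_1,p_2,p_3)$ be a H\"older related triplet with $p_3>\frac12$. Let $\Lambda(x_1,x_2)=(1-|x_1|)(1-|x_2|)$ for $(x_1,x_2)\in[-1,1)\times[-1,1)$ and $\Lambda(x_1,x_2)=0$ otherwise. Then there is a constant $c$, independent of $\phi$, such that for every $\phi\in M_{p_1,p_2}^{p_3}(\mathbb{T})$ the function $$\psi(\xi,\eta):=\sum_{n,m\in\mathbb{Z}}\phi(n,m)\Lambda(\xi-n,\eta-m)$$ belongs to $M_{p_1,p_2}^{p_3}(\mathbb{R})$ and $\|\psi\|\le c\|\phi\|$.
   Context: A triplet $(p_1,p_2,p_3)$ is H\"older related if $\frac1{p_1}+\frac1{p_2}=\frac1{p_3}$, where $p_1,p_2\ge 1$ and $p_3\ge \frac12$ (the value $\infty$ is allowed, with $1/\infty=0$). $\hat f(\xi)=\int_{\mathbb{R}} f(x)e^{-2\pi i x\xi}\,dx$ denotes the Fourier transform on $\mathbb{R}$. $\mathbb{T}=\mathbb{R}/\mathbb{Z}$ is identified with $[-\frac12,\frac12)$ with Lebesgue measure; Fourier coefficients are $\hat F(n)=\int_{\mathbb{T}} F(x)e^{-2\pi i nx}\,dx$. Multipliers on $\mathbb{R}$: for $\psi\in L^\infty(\mathbb{R}^2)$ and Schwartz functions $f,g\in\mathcal{S}(\mathbb{R})$ put $C_\psi(f,g)(x)=\int_{\mathbb{R}}\int_{\mathbb{R}}\hat f(\xi)\hat g(\eta)\psi(\xi,\eta)e^{2\pi i x(\xi+\eta)}\,d\xi\,d\eta$. Then $\psi\in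 M_{p_1,p_2}^{p_3}(\mathbb{R})$ means that there is a constant $C$ with $\|C_\psi(f,g)\|_{L^{p_3}(\mathbb{R})}\le C\|f\|_{L^{p_1}(\mathbb{R})}\|g\|_{L^{p_2}(\mathbb{R})}$ for all $f,g\in\mathcal{S}(\mathbb{R})$; $\|\psi\|$ denotes the least such $C$. Multipliers on $\mathbb{T}$: $\phi:\mathbb{Z}^2\to\mathbb{C}$ belongs to $M_{p_1,p_2}^{p_3}(\mathbb{T})$ if there is a constant $C$ such that, for all trigonometric polynomials $F,G$ on $\mathbb{T}$, the function $P_\phi(F,G)(x)=\sum_{n,m}\hat F(n)\hat G(m)\phi(n,m)e^{2\pi i x(n+m)}$ satisfies $\|P_\phi(F,G)\|_{L^{p_3}(\mathbb{T})}\le C\|F\|_{L^{p_1}(\mathbb{T})}\|G\|_{L^{p_2}(\mathbb{T})}$; $\|\phi\|$ denotes the least such $C$. *)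

theory Defs
  imports "HOL-Analysis.Analysis" "HOL-Probability.Essential_Supremum"
begin

text \<open>Exponents are extended nonnegative reals; in \<^typ>\<open>ennreal\<close> we have \<open>1 / \<infinity> = 0\<close>.\<close>

definition holder_related :: "ennreal \<Rightarrow> ennreal \<Rightarrow> ennreal \<Rightarrow> bool" where
  "holder_related p1 p2 p3 \<longleftrightarrow> p1 \<ge> 1 \<and> p2 \<ge> 1 \<and> p3 \<ge> 1 / 2 \<and> 1 / p1 + 1 / p2 = 1 / p3"

text \<open>The value \<open>\<infinity>\<close> is possible. For finite \<open>p < 1\<close> this is only a quasinorm. The case
  distinction on \<open>I\<close> is needed because \<open>powr\<close> is not available on \<^typ>\<open>ennreal\<close>.\<close>

definition Lp_norm :: "ennreal \<Rightarrow> 'a measure \<Rightarrow> ('a \<Rightarrow> complex) \<Rightarrow> ennreal" where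
  "Lp_norm p M f =
     (if p = \<infinity> then esssup M (\<lambda>x. ennreal (cmod (f x)))
      else let I = (\<integral>\<^sup>+x. ennreal (cmod (f x) powr enn2real p) \<partial>M)
           in if I = \<infinity> then \<infinity> else ennreal (enn2real I powr (1 / enn2real p)))"

definition L_infinity :: "'a measure \<Rightarrow> ('a \<Rightarrow> complex) set" where
  "L_infinity M = {f \<in> borel_measurable M. Lp_norm \<infinity> M f < \<infinity>}"


text \<open>\<open>D n\<close> is the \<open>n\<close>-th derivative of \<open>f\<close>.\<close>

definition schwartz :: "(real \<Rightarrow> complex) set" where
  "schwartz = {f. \<exists>D :: nat \<Rightarrow> real \<Rightarrow> complex. D 0 = f \<and>
      (\<forall>n x. (D n has_vector_derivative D (Suc n) x) (at x)) \<and>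
      (\<forall>k n. bounded (range (\<lambda>x. of_real (x ^ k) * D n x)))}"

definition fourier :: "(real \<Rightarrow> complex) \<Rightarrow> real \<Rightarrow> complex" where
  "fourier f \<xi> = (LINT x|lebesgue. f x * cis (- 2 * pi * x * \<xi>))"

definition bilin_R ::
  "(real \<times> real \<Rightarrow> complex) \<Rightarrow> (real \<Rightarrow> complex) \<Rightarrow> (real \<Rightarrow> complex) \<Rightarrow> real \<Rightarrow> complex" where
  "bilin_R \<psi> f g x =
     (LINT \<eta>|lebesgue. LINT \<xi>|lebesgue.
        fourier f \<xi> * fourier g \<eta> * \<psi> (\<xi>, \<eta>) * cis (2 * pi * x * (\<xi> + \<eta>)))"

definition bound_R ::
  "ennreal \<Rightarrow> ennreal \<Rightarrow> ennreal \<Rightarrow> (real \<times> real \<Rightarrow> complex) \<Rightarrow> real \<Rightarrow> bool" where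
  "bound_R p1 p2 p3 \<psi> C \<longleftrightarrow> C \<ge> 0 \<and>
     (\<forall>f\<in>schwartz. \<forall>g\<in>schwartz.
        Lp_norm p3 lebesgue (bilin_R \<psi> f g)
          \<le> ennreal C * Lp_norm p1 lebesgue f * Lp_norm p2 lebesgue g)"

definition multipliers_R ::
  "ennreal \<Rightarrow> ennreal \<Rightarrow> ennreal \<Rightarrow> (real \<times> real \<Rightarrow> complex) set" where
  "multipliers_R p1 p2 p3 = {\<psi> \<in> L_infinity lebesgue. \<exists>C. bound_R p1 p2 p3 \<psi> C}"

definition multiplier_norm_R ::
  "ennreal \<Rightarrow> ennreal \<Rightarrow> ennreal \<Rightarrow> (real \<times> real \<Rightarrow> complex) \<Rightarrow> real" where
  "multiplier_norm_R p1 p2 p3 \<psi> = Inf {C. bound_R p1 p2 p3 \<psi> C}"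


text \<open>Functions on \<open>\<real>/\<int>\<close> are represented by 1-periodic functions on \<open>\<real>\<close>, and integrated over
  the fundamental domain \<open>[-1/2, 1/2)\<close>.\<close>

abbreviation torus :: "real measure" where
  "torus \<equiv> lebesgue_on {- 1 / 2 ..< 1 / 2}"

definition trig_polys :: "(real \<Rightarrow> complex) set" where
  "trig_polys = {F. \<exists>(A :: int set) a. finite A \<and>
      F = (\<lambda>x. \<Sum>n\<in>A. a n * cis (2 * pi * of_int n * x))}"

definition fourier_coeff :: "(real \<Rightarrow> complex) \<Rightarrow> int \<Rightarrow> complex" where
  "fourier_coeff F n = (LINT x|torus. F x * cis (- 2 * pi * of_int n * x))"

text \<open>For trigonometric polynomials only finitely many terms are nonzero.\<close>

definition bilin_T ::
  "(int \<times> int \<Rightarrow> complex) \<Rightarrow> (real \<Rightarrow> complex) \<Rightarrow> (real \<Rightarrow> complex) \<Rightarrow> real \<Rightarrow> complex" where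
  "bilin_T \<phi> F G x =
     (\<Sum>\<^sub>\<infinity>(n, m)\<in>UNIV.
        fourier_coeff F n * fourier_coeff G m * \<phi> (n, m) * cis (2 * pi * x * of_int (n + m)))"

definition bound_T ::
  "ennreal \<Rightarrow> ennreal \<Rightarrow> ennreal \<Rightarrow> (int \<times> int \<Rightarrow> complex) \<Rightarrow> real \<Rightarrow> bool" where
  "bound_T p1 p2 p3 \<phi> C \<longleftrightarrow> C \<ge> 0 \<and>
     (\<forall>F\<in>trig_polys. \<forall>G\<in>trig_polys.
        Lp_norm p3 torus (bilin_T \<phi> F G)
          \<le> ennreal C * Lp_norm p1 torus F * Lp_norm p2 torus G)"

definition multipliers_T ::
  "ennreal \<Rightarrow> ennreal \<Rightarrow> ennreal \<Rightarrow> (int \<times> int \<Rightarrow> complex) set" where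
  "multipliers_T p1 p2 p3 = {\<phi>. \<exists>C. bound_T p1 p2 p3 \<phi> C}"

definition multiplier_norm_T ::
  "ennreal \<Rightarrow> ennreal \<Rightarrow> ennreal \<Rightarrow> (int \<times> int \<Rightarrow> complex) \<Rightarrow> real" where
  "multiplier_norm_T p1 p2 p3 \<phi> = Inf {C. bound_T p1 p2 p3 \<phi> C}"


definition tent :: "real \<times> real \<Rightarrow> real" where
  "tent = (\<lambda>(x1, x2). if x1 \<in> {-1..<1} \<and> x2 \<in> {-1..<1} then (1 - \<bar>x1\<bar>) * (1 - \<bar>x2\<bar>) else 0)"

text \<open>The sum is locally finite: at most four terms are nonzero at each point.\<close>

definition tent_extension :: "(int \<times> int \<Rightarrow> complex) \<Rightarrow> real \<times> real \<Rightarrow> complex" where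
  "tent_extension \<phi> = (\<lambda>(\<xi>, \<eta>).
     \<Sum>\<^sub>\<infinity>(n, m)\<in>UNIV. \<phi> (n, m) * of_real (tent (\<xi> - of_int n, \<eta> - of_int m)))"

end

theory Submission
  imports Defs "HOL-Probability.Sinc_Integral"
begin

text \<open>
  Write \<open>x = k + t\<close> with \<open>k\<close> an integer and \<open>|t| \<le> 1/2\<close>. Because the tent is a product, the operator with symbol
  \<open>tent_extension \<phi>\<close> maps \<open>f, g\<close> to the sum over \<open>n, m\<close> of \<open>\<phi> (n, m) * A n x * B m x\<close>, where \<open>A n x\<close> is the inverse
  Fourier transform at \<open>x\<close> of \<open>fourier f\<close> multiplied by the triangle function around \<open>n\<close>, and \<open>B m x\<close> likewise for \<open>g\<close>.
  On that triangle \<open>\<xi> = n + s\<close> with \<open>|s| \<le> 1\<close>, so \<open>cis (2 * pi * t * \<xi>)\<close> is \<open>character n t\<close> times an exponential series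
  in \<open>t * s\<close>. Hence \<open>A n (k + t)\<close> is \<open>character n t\<close> times a series with terms \<open>(2 * pi * \<i> * t) ^ a / fact a\<close>
  times numbers independent of \<open>t\<close> (\<open>frequency_piece_taylor\<close>). The \<open>a\<close>-th of these numbers is the \<open>n\<close>-th Fourier
  coefficient of the periodisation \<open>F k a\<close> of \<open>f\<close> times a kernel centred at \<open>k\<close>, whose decay is quadratic
  (\<open>tri_moment_decay\<close>, \<open>frequency_piece_eq_moment_integral\<close>). So on the block around \<open>k\<close> the operator on the line is a
  rapidly convergent double series, with factors that are powers of \<open>t\<close>, of the torus operator applied to \<open>F k a\<close> and
  \<open>G k b\<close>. For the truncations introduced below this is the exact identity \<open>bilin_R_fejer_extension_series\<close>.

  Now the torus bound applies on each block, and it remains to sum over \<open>k\<close>. Hoelder's inequality on the integers,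
  with the given Hoelder related exponents, reduces this to the estimate that the norms of
  \<open>F k a\<close>, as a sequence in \<open>k\<close>, have \<open>\<ell>\<^sup>p\<close> norm at most a multiple of the norm of \<open>f\<close>. That estimate is Young's
  inequality for convolution with an integrable kernel (\<open>fejer_poly_Lp_norm\<close>). The sum over the Taylor indices
  converges so fast that it can be estimated term by term even for a quasinorm (\<open>Lp_norm_double_series\<close>); this is
  what allows target exponents below 1.

  Multipliers on the torus are tested on trigonometric polynomials only, so \<open>F k a\<close> has to be truncated.
  Fejer means do this without enlarging norms, because the Fejer kernel is nonnegative and has mass 1. On the line they
  correspond to giving each \<open>\<phi> (n, m)\<close> a product of two Fejer weights. The bounds are uniform in the
  truncation, the truncated symbols converge boundedly, and Fatou's lemma (\<open>Lp_norm_Fatou\<close>) yields the theorem.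
\<close>

section \<open>Lebesgue norms and Hoelder's inequality\<close>

text \<open>For finite \<open>r\<close> every norm bound below is checked at the level of the \<open>r\<close>-th power integral. This is
  the form in which sums over blocks and over series add up, also in the quasinorm range \<open>r < 1\<close>.\<close>

lemma Lp_norm_le_iff:
  assumes "r > 0" "c \<ge> 0"
  shows "Lp_norm (ennreal r) M f \<le> ennreal c \<longleftrightarrow>
         (\<integral>\<^sup>+x. ennreal (cmod (f x) powr r) \<partial>M) \<le> ennreal (c powr r)"
proof -
  define I where "I = (\<integral>\<^sup>+x. ennreal (cmod (f x) powr r) \<partial>M)"
  have L: "Lp_norm (ennreal r) M f = (if I = \<infinity> then \<infinity> else ennreal (enn2real I powr (1 / r)))"
    using assms unfolding Lp_norm_def I_def by (simp add: Let_def)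
  show ?thesis
  proof (cases "I = \<infinity>")
    case True
    then show ?thesis using L I_def by (simp add: top_unique)
  next
    case False
    then obtain i where i: "I = ennreal i" "i \<ge> 0" by (cases I) auto
    have "i powr (1 / r) \<le> c \<longleftrightarrow> i \<le> c powr r"
    proof
      assume "i powr (1 / r) \<le> c"
      then have "(i powr (1 / r)) powr r \<le> c powr r"
        using assms by (intro powr_mono2) auto
      then show "i \<le> c powr r" using i assms by (simp add: powr_powr)
    next
      assume "i \<le> c powr r"
      then have "i powr (1 / r) \<le> (c powr r) powr (1 / r)"
        using assms i by (intro powr_mono2) auto
      then show "i powr (1 / r) \<le> c" using assms by (simp add: powr_powr)
    qed
    then show ?thesis using L i assms unfolding I_def[symmetric] by simp
  qed
qed

lemma Lp_norm_infinity_AE: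
  assumes "Lp_norm \<infinity> M f \<le> ennreal c" "c \<ge> 0"
  shows "AE x in M. cmod (f x) \<le> c"
proof -
  have "AE x in M. ennreal (cmod (f x)) \<le> ennreal c"
    using esssup_AE[of "\<lambda>x. ennreal (cmod (f x))" M] assms(1)
    by (auto simp: Lp_norm_def elim!: eventually_mono intro: order_trans)
  then show ?thesis using assms(2) by simp
qed

lemma Lp_norm_infinity_leI:
  assumes "f \<in> borel_measurable M" "AE x in M. cmod (f x) \<le> c"
  shows "Lp_norm \<infinity> M f \<le> ennreal c"
  unfolding Lp_norm_def using assms by (auto intro!: esssup_I simp: ennreal_leI elim: eventually_mono)

text \<open>The exponents enter the estimates only through these four shapes; the last one is the only
  one in which all three are finite.\<close>

lemma holder_related_cases:
  assumes "holder_related p1 p2 p3"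
  obtains (inf) "p1 = \<infinity>" "p2 = \<infinity>" "p3 = \<infinity>"
  | (left) r where "p1 = \<infinity>" "p2 = ennreal r" "p3 = ennreal r" "r \<ge> 1"
  | (right) r where "p1 = ennreal r" "p2 = \<infinity>" "p3 = ennreal r" "r \<ge> 1"
  | (fin) r1 r2 r3 where "p1 = ennreal r1" "p2 = ennreal r2" "p3 = ennreal r3"
      "r1 \<ge> 1" "r2 \<ge> 1" "r3 > 0" "1 / r1 + 1 / r2 = 1 / r3"
proof -
  have h: "p1 \<ge> 1" "p2 \<ge> 1" "p3 \<ge> 1 / 2" "1 / p1 + 1 / p2 = 1 / p3"
    using assms by (auto simp: holder_related_def)
  have p3pos: "p3 > 0"
  proof -
    have "(0::ennreal) < 1 / 2" by (simp add: ennreal_zero_less_divide)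
    then show ?thesis using h(3) by (rule less_le_trans)
  qed
  have fin: "\<exists>r. p = ennreal r \<and> r \<ge> 1" if "p \<ge> 1" "p \<noteq> \<infinity>" for p :: ennreal
    using that by (cases p) (auto simp flip: ennreal_1)
  have inv_eq: "1 / p = ennreal (1 / r)" if "p = ennreal r" "r > 0" for p r
    using that by (simp add: divide_ennreal flip: ennreal_1)
  have inv_inj: "p3 = p" if "1 / p = 1 / p3" "p \<ge> 1" for p
  proof -
    have "inverse p = inverse p3" using that by (simp add: divide_ennreal_def)
    moreover have "p > 0" using that(2) by (rule less_le_trans[rotated]) simp
    ultimately show ?thesis using p3pos
      by (cases p; cases p3)
        (auto simp: inverse_ennreal ennreal_less_zero_iff top_unique ennreal_inverse_eq_0_iff)
  qed
  consider "p1 = \<infinity>" "p2 = \<infinity>" | "p1 = \<infinity>" "p2 \<noteq> \<infinity>" | "p1 \<noteq> \<infinity>" "p2 = \<infinity>" | "p1 \<noteq> \<infinity>" "p2 \<noteq> \<infinity>"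
    by blast
  then show ?thesis
  proof cases
    case 1
    then have "1 / p3 = 0" using h(4) by (simp add: ennreal_divide_top)
    then have "p3 = \<infinity>" by (auto simp: divide_ennreal_def ennreal_inverse_eq_0_iff)
    then show ?thesis using 1 inf by blast
  next
    case 2
    then have "1 / p2 = 1 / p3" using h(4) by simp
    then have "p3 = p2" using inv_inj h(2) by blast
    moreover obtain r where "p2 = ennreal r" "r \<ge> 1" using fin 2 h(2) by blast
    ultimately show ?thesis using left 2 by blast
  next
    case 3
    then have "1 / p1 = 1 / p3" using h(4) by simp
    then have "p3 = p1" using inv_inj h(1) by blast
    moreover obtain r where "p1 = ennreal r" "r \<ge> 1" using fin 3 h(1) by blast
    ultimately show ?thesis using right 3 by blast
  next
    case 4
    obtain r1 where r1: "p1 = ennreal r1" "r1 \<ge> 1" using fin 4 h(1) by blast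
    obtain r2 where r2: "p2 = ennreal r2" "r2 \<ge> 1" using fin 4 h(2) by blast
    have s: "ennreal (1 / r1 + 1 / r2) = 1 / p3"
      using h(4) inv_eq[OF r1(1)] inv_eq[OF r2(1)] r1 r2 by simp
    have pos: "1 / r1 + 1 / r2 > 0" using r1 r2 by (simp add: add_pos_pos)
    have "p3 \<noteq> \<infinity>"
    proof
      assume "p3 = \<infinity>"
      then have "ennreal (1 / r1 + 1 / r2) = 0" using s by simp
      then show False using pos by (simp add: ennreal_eq_0_iff)
    qed
    then obtain r3 where r3: "p3 = ennreal r3" "r3 > 0"
      using p3pos by (cases p3) (auto simp: ennreal_less_zero_iff)
    have "ennreal (1 / r1 + 1 / r2) = ennreal (1 / r3)" using s inv_eq[OF r3] by simp
    then have "1 / r1 + 1 / r2 = 1 / r3" using pos r3 by (subst (asm) ennreal_inj) auto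
    then show ?thesis using r1 r2 r3 fin that(4) by blast
  qed
qed

lemma Lp_norm_eq_zero_AE:
  assumes "r > 0" "f \<in> borel_measurable M" "Lp_norm (ennreal r) M f \<le> 0"
  shows "AE x in M. f x = 0"
proof -
  have "(\<integral>\<^sup>+x. ennreal (cmod (f x) powr r) \<partial>M) = 0"
    using Lp_norm_le_iff[of r 0 M f] assms by simp
  then have "AE x in M. ennreal (cmod (f x) powr r) = 0"
    using assms by (subst (asm) nn_integral_0_iff_AE) auto
  then show ?thesis
    by (rule eventually_mono) (auto simp: ennreal_eq_0_iff powr_def not_le split: if_splits)
qed

text \<open>The endpoint case of Hoelder's inequality, in which one factor is essentially bounded.\<close>

lemma Lp_norm_mult_bounded:
  assumes r: "r > 0" and m[measurable]: "g \<in> borel_measurable M"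
    and f: "AE x in M. cmod (f x) \<le> a" and g: "Lp_norm (ennreal r) M g \<le> ennreal b"
    and ab: "a \<ge> 0" "b \<ge> 0"
  shows "Lp_norm (ennreal r) M (\<lambda>x. f x * g x) \<le> ennreal (a * b)"
proof -
  have "(\<integral>\<^sup>+x. ennreal (cmod (f x * g x) powr r) \<partial>M)
      \<le> (\<integral>\<^sup>+x. ennreal (a powr r) * ennreal (cmod (g x) powr r) \<partial>M)"
  proof (rule nn_integral_mono_AE, use f in eventually_elim)
    case (elim x)
    have "cmod (f x * g x) powr r \<le> (a * cmod (g x)) powr r"
      using elim r by (intro powr_mono2) (auto simp: norm_mult mult_right_mono)
    then show ?case using ab by (simp add: powr_mult flip: ennreal_mult)
  qed
  also have "\<dots> = ennreal (a powr r) * (\<integral>\<^sup>+x. ennreal (cmod (g x) powr r) \<partial>M)"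
    by (rule nn_integral_cmult) simp
  also have "\<dots> \<le> ennreal (a powr r) * ennreal (b powr r)"
    using g Lp_norm_le_iff[OF r ab(2)] by (intro mult_left_mono) auto
  also have "\<dots> = ennreal ((a * b) powr r)"
    using ab by (simp add: powr_mult flip: ennreal_mult)
  finally show ?thesis using ab by (subst Lp_norm_le_iff[OF r]) auto
qed

text \<open>Hoelder's inequality in the normalised form suited to bounds: the integrand is compared with
  the weighted sum of \<open>(|f| / a)\<close> and \<open>(|g| / b)\<close>, raised to the powers \<open>r1\<close> and \<open>r2\<close>, by Young's
  inequality with weights \<open>r3 / r1\<close> and \<open>r3 / r2\<close>. The comparison is pointwise and therefore covers
  \<open>r3 < 1\<close>. It is used with the counting measure on the integers.\<close>

lemma Holder_inequality:
  assumes "holder_related p1 p2 p3"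
    and [measurable]: "f \<in> borel_measurable M" "g \<in> borel_measurable M"
    and f: "Lp_norm p1 M f \<le> ennreal a" and g: "Lp_norm p2 M g \<le> ennreal b"
    and ab: "a \<ge> 0" "b \<ge> 0"
  shows "Lp_norm p3 M (\<lambda>x. f x * g x) \<le> ennreal (a * b)"
  using assms(1)
proof (cases rule: holder_related_cases)
  case inf
  have "AE x in M. cmod (f x) \<le> a" "AE x in M. cmod (g x) \<le> b"
    using Lp_norm_infinity_AE f g ab inf by blast+
  then have "AE x in M. cmod (f x * g x) \<le> a * b"
    by eventually_elim (use ab in \<open>auto simp: norm_mult intro!: mult_mono\<close>)
  then have "Lp_norm \<infinity> M (\<lambda>x. f x * g x) \<le> ennreal (a * b)"
    by (intro Lp_norm_infinity_leI) auto
  then show ?thesis using inf by simp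
next
  case (left r)
  then show ?thesis
    using Lp_norm_mult_bounded[of r g M f a b] Lp_norm_infinity_AE f g ab by auto
next
  case (right r)
  then show ?thesis
    using Lp_norm_mult_bounded[of r f M g b a] Lp_norm_infinity_AE[of M g b] f g ab
    by (auto simp: mult.commute)
next
  case (fin r1 r2 r3)
  show ?thesis
  proof (cases "a = 0 \<or> b = 0")
    case True
    then have "AE x in M. f x * g x = 0"
    proof
      assume "a = 0"
      then have "AE x in M. f x = 0" using Lp_norm_eq_zero_AE[of r1 f M] f fin by auto
      then show ?thesis by eventually_elim simp
    next
      assume "b = 0"
      then have "AE x in M. g x = 0" using Lp_norm_eq_zero_AE[of r2 g M] g fin by auto
      then show ?thesis by eventually_elim simp
    qed
    then have "(\<integral>\<^sup>+x. ennreal (cmod (f x * g x) powr r3) \<partial>M) = 0"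
      by (subst nn_integral_0_iff_AE) (auto elim: eventually_mono)
    then show ?thesis using fin ab by (simp add: Lp_norm_le_iff)
  next
    case False
    then have a: "a > 0" and b: "b > 0" using ab by auto
    define s t where "s = r3 / r1" and "t = r3 / r2"
    have st: "s \<ge> 0" "t \<ge> 0" "s + t = 1"
      using fin by (auto simp: s_def t_def field_simps)
    have rs: "r1 * s = r3" "r2 * t = r3" using fin by (auto simp: s_def t_def)
    \<comment> \<open>The coefficients that turn the normalised Young inequality into one for \<open>f\<close> and \<open>g\<close>.\<close>
    define K1 where "K1 = (a * b) powr r3 * s / a powr r1"
    define K2 where "K2 = (a * b) powr r3 * t / b powr r2"
    have K: "K1 \<ge> 0" "K2 \<ge> 0" using st by (auto simp: K1_def K2_def)
    have young: "(u * v) powr r3 \<le> K1 * u powr r1 + K2 * v powr r2" if uv: "u \<ge> 0" "v \<ge> 0" for u v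
    proof (cases "u = 0 \<or> v = 0")
      case True
      then show ?thesis using K by auto
    next
      case False
      then have u: "u > 0" "v > 0" using uv by auto
      have "((u / a) powr r1) powr s * ((v / b) powr r2) powr t
          \<le> s * (u / a) powr r1 + t * (v / b) powr r2"
        using st u a b by (intro Youngs_inequality_0) auto
      then have "(u / a) powr r3 * (v / b) powr r3 \<le> s * (u / a) powr r1 + t * (v / b) powr r2"
        by (simp add: powr_powr rs)
      then have "(a * b) powr r3 * ((u / a) powr r3 * (v / b) powr r3)
          \<le> (a * b) powr r3 * (s * (u / a) powr r1 + t * (v / b) powr r2)"
        by (rule mult_left_mono) simp
      then show ?thesis using a b u
        by (simp add: K1_def K2_def powr_mult powr_divide field_simps)
    qed
    have "(\<integral>\<^sup>+x. ennreal (cmod (f x * g x) powr r3) \<partial>M)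
      \<le> (\<integral>\<^sup>+x. ennreal K1 * ennreal (cmod (f x) powr r1) + ennreal K2 * ennreal (cmod (g x) powr r2) \<partial>M)"
      using young K
      by (intro nn_integral_mono) (simp add: norm_mult flip: ennreal_mult ennreal_plus)
    also have "\<dots> = ennreal K1 * (\<integral>\<^sup>+x. ennreal (cmod (f x) powr r1) \<partial>M)
        + ennreal K2 * (\<integral>\<^sup>+x. ennreal (cmod (g x) powr r2) \<partial>M)"
      by (simp add: nn_integral_add nn_integral_cmult)
    also have "\<dots> \<le> ennreal K1 * ennreal (a powr r1) + ennreal K2 * ennreal (b powr r2)"
      using f g fin ab Lp_norm_le_iff[of r1 a M f] Lp_norm_le_iff[of r2 b M g]
      by (intro add_mono mult_left_mono) auto
    also have "\<dots> = ennreal (K1 * a powr r1 + K2 * b powr r2)"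
      using K by (simp add: ennreal_mult)
    also have "K1 * a powr r1 + K2 * b powr r2 = (a * b) powr r3"
      using a b st(3) by (simp add: K1_def K2_def flip: distrib_left)
    finally show ?thesis using fin ab by (simp add: Lp_norm_le_iff)
  qed
qed

text \<open>A convex function lies above its tangent at \<open>\<mu>\<close>; this is Young's inequality for \<open>x\<close> and
  \<open>\<mu> powr (p - 1)\<close>.\<close>

lemma powr_tangent:
  fixes x \<mu> p :: real
  assumes "x \<ge> 0" "\<mu> > 0" "p \<ge> 1"
  shows "p * \<mu> powr (p - 1) * x - (p - 1) * \<mu> powr p \<le> x powr p"
proof (cases "p = 1")
  case True
  then show ?thesis using assms by simp
next
  case False
  then have p: "p > 1" using assms by simp
  define q where "q = p / (p - 1)"
  have q: "q > 1" "1 / p + 1 / q = 1" "(p - 1) * q = p"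
    using p by (auto simp: q_def field_simps)
  have "x * \<mu> powr (p - 1) \<le> x powr p / p + (\<mu> powr (p - 1)) powr q / q"
    using p q assms by (intro Youngs_inequality) auto
  then have "x * \<mu> powr (p - 1) \<le> x powr p / p + \<mu> powr p / q"
    by (simp add: powr_powr q)
  then have "p * (x * \<mu> powr (p - 1)) \<le> p * (x powr p / p + \<mu> powr p / q)"
    using p by (intro mult_left_mono) auto
  also have "p * (x powr p / p + \<mu> powr p / q) = x powr p + (p - 1) * \<mu> powr p"
    using p by (simp add: q_def distrib_left)
  finally show ?thesis by (simp add: algebra_simps)
qed

text \<open>Jensen's inequality for a weight whose mass is only bounded by \<open>W\<close>: integrate the tangent
  inequality at the point \<open>\<mu> = (\<integral>fw) / W\<close>.\<close>

lemma weighted_power_mean: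
  fixes f w :: "'a \<Rightarrow> real"
  assumes nn: "\<And>x. f x \<ge> 0" "\<And>x. w x \<ge> 0" and p: "p \<ge> 1" and W: "integral\<^sup>L M w \<le> W" "W > 0"
    and i: "integrable M w" "integrable M (\<lambda>x. f x * w x)" "integrable M (\<lambda>x. f x powr p * w x)"
  shows "(\<integral>x. f x * w x \<partial>M) powr p \<le> W powr (p - 1) * (\<integral>x. f x powr p * w x \<partial>M)"
proof (cases "(\<integral>x. f x * w x \<partial>M) = 0")
  case True
  then show ?thesis using nn by (simp add: integral_nonneg)
next
  case False
  define J where "J = (\<integral>x. f x * w x \<partial>M)"
  define \<mu> where "\<mu> = J / W"
  have J: "J > 0" using False nn by (simp add: J_def less_le)
  then have mu: "\<mu> > 0" using W by (simp add: \<mu>_def)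
  have "p * \<mu> powr (p - 1) * J - (p - 1) * \<mu> powr p * W
      \<le> p * \<mu> powr (p - 1) * J - (p - 1) * \<mu> powr p * (\<integral>x. w x \<partial>M)"
    using p W by (intro diff_mono mult_left_mono) auto
  also have "\<dots> = (\<integral>x. p * \<mu> powr (p - 1) * (f x * w x) - (p - 1) * \<mu> powr p * w x \<partial>M)"
    using i by (simp add: J_def)
  also have "\<dots> \<le> (\<integral>x. f x powr p * w x \<partial>M)"
  proof (rule integral_mono)
    fix x
    have "(p * \<mu> powr (p - 1) * f x - (p - 1) * \<mu> powr p) * w x \<le> f x powr p * w x"
      using powr_tangent[OF nn(1)[of x] mu p] nn(2) by (rule mult_right_mono)
    then show "p * \<mu> powr (p - 1) * (f x * w x) - (p - 1) * \<mu> powr p * w x \<le> f x powr p * w x"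
      by (simp add: algebra_simps)
  qed (use i in auto)
  finally have le: "p * \<mu> powr (p - 1) * J - (p - 1) * \<mu> powr p * W \<le> (\<integral>x. f x powr p * w x \<partial>M)" .
  have "\<mu> powr (p - 1) * J = \<mu> powr p * W"
    using mu W J by (simp add: powr_diff \<mu>_def)
  then have "p * \<mu> powr (p - 1) * J = p * (\<mu> powr p * W)" by simp
  with le have "\<mu> powr p * W \<le> (\<integral>x. f x powr p * w x \<partial>M)"
    by (simp add: left_diff_distrib)
  then have "W powr (p - 1) * (\<mu> powr p * W) \<le> W powr (p - 1) * (\<integral>x. f x powr p * w x \<partial>M)"
    by (rule mult_left_mono) simp
  moreover have "W powr (p - 1) * (\<mu> powr p * W) = J powr p"
    using W J by (simp add: \<mu>_def powr_divide powr_diff)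
  ultimately show ?thesis by (simp add: J_def)
qed

section \<open>Characters, the torus and Fejer kernels\<close>

definition character :: "int \<Rightarrow> real \<Rightarrow> complex" where
  "character n x = cis (2 * pi * of_int n * x)"

lemma character_add: "character (n + m) x = character n x * character m x"
  by (simp add: character_def cis_mult algebra_simps)

lemma character_add_arg: "character n (x + y) = character n x * character n y"
  by (simp add: character_def cis_mult algebra_simps)

lemma character_of_int [simp]: "character n (of_int k) = 1"
proof -
  have "character n (of_int k) = cis (2 * pi * of_int (n * k))"
    by (simp add: character_def algebra_simps)
  also have "\<dots> = 1" by (rule cis_multiple_2pi) simp
  finally show ?thesis .
qed

lemma character_zero [simp]: "character 0 x = 1"
  by (simp add: character_def)

lemma norm_character [simp]: "cmod (character n x) = 1"
  by (simp add: character_def)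

lemma character_minus: "character (- n) x = cnj (character n x)"
  by (simp add: character_def cis_cnj)

lemma character_minus_arg: "character n (- x) = character (- n) x"
  by (simp add: character_def)

lemma character_measurable [measurable]: "character n \<in> borel_measurable borel"
  unfolding character_def by (intro borel_measurable_continuous_onI continuous_intros)

interpretation torus: prob_space torus
proof
  have "emeasure torus {- 1 / 2 ..< 1 / 2} = emeasure lebesgue {- 1 / 2 ..< 1 / 2 :: real}"
    by (subst emeasure_restrict_space) auto
  also have "\<dots> = 1" by simp
  finally show "emeasure torus (space torus) = 1" by simp
qed

lemma torus_integrable_bounded:
  assumes "f \<in> borel_measurable borel" "\<And>x. cmod (f x) \<le> B"
  shows "integrable torus f"
proof (rule torus.integrable_const_bound)
  have "f \<in> borel_measurable lebesgue" using assms(1) by (simp add: measurable_completion)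
  then show "f \<in> borel_measurable torus" by (rule measurable_restrict_space1)
qed (use assms in auto)

lemma borel_measurable_torus:
  assumes "f \<in> borel_measurable borel"
  shows "f \<in> borel_measurable torus"
proof -
  have "f \<in> borel_measurable lebesgue" using assms(1) by (simp add: measurable_completion)
  then show ?thesis by (rule measurable_restrict_space1)
qed

lemma integrable_character: "integrable torus (character n)"
  by (rule torus_integrable_bounded[where B = 1]) auto

lemma has_vector_derivative_cis:
  "((\<lambda>x. cis (c * x)) has_vector_derivative \<i> * of_real c * cis (c * x)) (at x within S)"
proof -
  have "((\<lambda>z. exp (\<i> * of_real c * z)) has_field_derivative \<i> * of_real c * exp (\<i> * of_real c * of_real x))
      (at (of_real x))"
    by (auto intro!: derivative_eq_intros)
  then show ?thesis
    using has_vector_derivative_real_field[of "\<lambda>z. exp (\<i> * of_real c * z)"]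
    by (simp add: cis_conv_exp mult.assoc)
qed

lemma integral_character: "(LINT x|torus. character n x) = (if n = 0 then 1 else 0)"
proof (cases "n = 0")
  case True
  then show ?thesis using torus.prob_space by simp
next
  case False
  define F where "F x = character n x / (2 * pi * \<i> * of_int n)" for x
  have "(character n has_integral (F (1/2) - F (-1/2))) {-1/2..1/2}"
  proof (rule fundamental_theorem_of_calculus)
    fix x :: real
    have "(F has_vector_derivative
        (\<i> * of_real (2 * pi * of_int n) * character n x) / (2 * pi * \<i> * of_int n)) (at x within {-1/2..1/2})"
      unfolding F_def character_def
      by (intro has_vector_derivative_divide has_vector_derivative_cis)
    then show "(F has_vector_derivative character n x) (at x within {-1/2..1/2})"
      using False by (simp add: field_simps)
  qed simp
  moreover have "F (1/2) = F (-1/2)"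
  proof -
    have "character n (1/2) = character n (-1/2 + of_int 1)" by simp
    also have "\<dots> = character n (-1/2)" unfolding character_add_arg by (simp del: of_int_1)
    finally show ?thesis by (simp add: F_def)
  qed
  ultimately have "(character n has_integral 0) {-1/2..1/2}" by simp
  then have "(character n has_integral 0) {-1/2..<1/2}"
    by (subst (asm) has_integral_spike_set_eq[where T = "{-1/2..<1/2}"])
      (auto intro: negligible_subset[of "{1/2}"])
  moreover have "(LINT x|torus. character n x) = integral {-1/2..<1/2} (character n)"
    using integrable_character[of n] by (intro lebesgue_integral_eq_integral) auto
  ultimately show ?thesis using False by (simp add: integral_unique)
qed

lemma fourier_coeff_trig_poly:
  assumes "finite A"
  shows "fourier_coeff (\<lambda>x. \<Sum>n\<in>A. a n * character n x) m = (if m \<in> A then a m else 0)"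
proof -
  have "fourier_coeff (\<lambda>x. \<Sum>n\<in>A. a n * character n x) m
      = (LINT x|torus. (\<Sum>n\<in>A. a n * character (n + (- m)) x))"
    unfolding fourier_coeff_def character_add
    by (intro Bochner_Integration.integral_cong refl)
       (simp add: sum_distrib_right mult.assoc character_def)
  also have "\<dots> = (\<Sum>n\<in>A. a n * (if n = m then 1 else 0))"
    by (subst Bochner_Integration.integral_sum)
       (auto simp only: integral_character integral_mult_right_zero add_uminus_conv_diff
          right_minus_eq intro!: integrable_mult_right integrable_character sum.cong)
  also have "\<dots> = (\<Sum>n\<in>A. if n = m then a n else 0)" by (intro sum.cong) auto
  also have "\<dots> = (if m \<in> A then a m else 0)" using assms by simp
  finally show ?thesis .
qed

lemma trig_poly_in_trig_polys: "finite A \<Longrightarrow> (\<lambda>x. \<Sum>n\<in>A. a n * character n x) \<in> trig_polys"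
  unfolding trig_polys_def character_def by blast

lemma bilin_T_trig_poly:
  assumes "finite A" "finite B"
  shows "bilin_T \<phi> (\<lambda>x. \<Sum>n\<in>A. a n * character n x) (\<lambda>x. \<Sum>m\<in>B. b m * character m x) x
    = (\<Sum>n\<in>A. \<Sum>m\<in>B. \<phi> (n, m) * (a n * character n x) * (b m * character m x))"
proof -
  have cis_eq: "cis (2 * pi * x * (of_int (n + m))) = character n x * character m x" for n m
    by (simp add: character_def cis_mult algebra_simps)
  have "bilin_T \<phi> (\<lambda>x. \<Sum>n\<in>A. a n * character n x) (\<lambda>x. \<Sum>m\<in>B. b m * character m x) x
    = (\<Sum>\<^sub>\<infinity>(n, m)\<in>A \<times> B. \<phi> (n, m) * (a n * character n x) * (b m * character m x))"
    unfolding bilin_T_def using assms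
    by (intro infsum_cong_neutral)
       (auto simp: fourier_coeff_trig_poly cis_eq simp del: of_int_add split: if_splits)
  also have "\<dots> = (\<Sum>(n, m)\<in>A \<times> B. \<phi> (n, m) * (a n * character n x) * (b m * character m x))"
    using assms by (intro infsum_finite) auto
  also have "\<dots> = (\<Sum>n\<in>A. \<Sum>m\<in>B. \<phi> (n, m) * (a n * character n x) * (b m * character m x))"
    by (rule sum.cartesian_product[symmetric])
  finally show ?thesis .
qed

definition fejer_weight :: "nat \<Rightarrow> int \<Rightarrow> real" where
  "fejer_weight N n = max 0 (1 - \<bar>of_int n\<bar> / of_nat N)"

definition fejer_kernel :: "nat \<Rightarrow> real \<Rightarrow> real" where
  "fejer_kernel N x = (cmod (\<Sum>j<N. character (int j) x))\<^sup>2 / of_nat N"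

text \<open>Writing the double sum as a single sum is the identity behind the Fejer kernel. Passing from
  \<open>N\<close> to \<open>N + 1\<close> adds one row, one column and a corner, which together give each difference
  \<open>n\<close> with \<open>|n| \<le> N\<close> exactly once.\<close>

lemma sum_differences:
  fixes g :: "int \<Rightarrow> complex"
  shows "(\<Sum>i<N. \<Sum>j<N. g (int i - int j)) = (\<Sum>n\<in>{-int N..int N}. of_int (int N - \<bar>n\<bar>) * g n)"
proof (induction N)
  case 0
  show ?case by simp
next
  case (Suc N)
  have s1: "(\<Sum>i<N. g (int i - int N)) = (\<Sum>n\<in>{-int N..<0}. g n)"
    by (rule sum.reindex_bij_witness[of _ "\<lambda>n. nat (n + int N)" "\<lambda>i. int i - int N"]) auto
  have s2: "(\<Sum>j<N. g (int N - int j)) = (\<Sum>n\<in>{0<..int N}. g n)"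
    by (rule sum.reindex_bij_witness[of _ "\<lambda>n. nat (int N - n)" "\<lambda>j. int N - int j"]) auto
  have "{-int N..int N} = {-int N..<0} \<union> {0} \<union> {0<..int N}" by auto
  then have s3: "(\<Sum>n\<in>{-int N..int N}. g n) = (\<Sum>n\<in>{-int N..<0}. g n) + g 0 + (\<Sum>n\<in>{0<..int N}. g n)"
    by (simp only:) (subst sum.union_disjoint; auto)+
  have "(\<Sum>n\<in>{-int (Suc N)..int (Suc N)}. of_int (int (Suc N) - \<bar>n\<bar>) * g n)
      = (\<Sum>n\<in>{-int N..int N}. of_int (int (Suc N) - \<bar>n\<bar>) * g n)"
  proof (rule sum.mono_neutral_right)
    show "\<forall>i\<in>{- int (Suc N)..int (Suc N)} - {- int N..int N}. of_int (int (Suc N) - \<bar>i\<bar>) * g i = 0"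
    proof
      fix i assume "i \<in> {- int (Suc N)..int (Suc N)} - {- int N..int N}"
      then have "int (Suc N) - \<bar>i\<bar> = 0" by auto
      then show "of_int (int (Suc N) - \<bar>i\<bar>) * g i = 0" by (simp only: of_int_0 mult_zero_left)
    qed
  qed auto
  also have "\<dots> = (\<Sum>n\<in>{-int N..int N}. of_int (int N - \<bar>n\<bar>) * g n) + (\<Sum>n\<in>{-int N..int N}. g n)"
    by (simp add: algebra_simps flip: sum.distrib)
  also have "\<dots> = (\<Sum>i<Suc N. \<Sum>j<Suc N. g (int i - int j))"
    unfolding Suc.IH[symmetric] s3 s1[symmetric] s2[symmetric]
    by (simp add: sum.distrib)
  finally show ?case by simp
qed

lemma fejer_weight_nonneg: "fejer_weight N n \<ge> 0"
  by (simp add: fejer_weight_def)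

lemma fejer_weight_le_1: "fejer_weight N n \<le> 1"
  by (simp add: fejer_weight_def)

lemma fejer_weight_tendsto: "(\<lambda>N. fejer_weight N n) \<longlonglongrightarrow> 1"
proof -
  have "(\<lambda>N. max 0 (1 - \<bar>of_int n\<bar> * inverse (real N))) \<longlonglongrightarrow> max 0 (1 - \<bar>of_int n\<bar> * 0)"
    by (intro tendsto_intros tendsto_inverse_0_at_top filterlim_real_sequentially)
  then show ?thesis by (simp add: fejer_weight_def[abs_def] divide_inverse)
qed

lemma fejer_kernel_nonneg: "fejer_kernel N x \<ge> 0"
  by (simp add: fejer_kernel_def)

text \<open>The square in the definition shows that the kernel is nonnegative, and the expansion shows
  that its Fourier coefficients are the Fejer weights. Nonnegativity is the reason for these weights: they
  cut a Fourier series down to a trigonometric polynomial without increasing \<open>L\<^sup>p\<close> norms.\<close>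

lemma fejer_kernel_expansion:
  assumes "N > 0"
  shows "complex_of_real (fejer_kernel N x)
    = (\<Sum>n\<in>{-int N..int N}. complex_of_real (fejer_weight N n) * character n x)"
proof -
  define S where "S = (\<Sum>j<N. character (int j) x)"
  have "complex_of_real (fejer_kernel N x) = S * cnj S / of_nat N"
    unfolding fejer_kernel_def S_def[symmetric] by (simp only: of_real_divide complex_norm_square of_real_of_nat_eq)
  also have "S * cnj S = (\<Sum>i<N. \<Sum>j<N. character (int i - int j) x)"
    unfolding S_def cnj_sum sum_product
    by (simp flip: character_minus character_add)
  also have "\<dots> = (\<Sum>n\<in>{-int N..int N}. of_int (int N - \<bar>n\<bar>) * character n x)"
    by (rule sum_differences)
  also have "\<dots> / of_nat N = (\<Sum>n\<in>{-int N..int N}. of_real (fejer_weight N n) * character n x)"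
    unfolding sum_divide_distrib
  proof (rule sum.cong[OF refl])
    fix n assume "n \<in> {-int N..int N}"
    then have "\<bar>of_int n\<bar> / real N \<le> 1" using assms by (auto simp: abs_le_iff)
    then have "fejer_weight N n = of_int (int N - \<bar>n\<bar>) / real N"
      using assms by (simp add: fejer_weight_def field_simps)
    then have "complex_of_real (fejer_weight N n) = of_int (int N - \<bar>n\<bar>) / of_nat N"
      by (simp only: of_real_divide of_real_of_int_eq of_real_of_nat_eq)
    then show "of_int (int N - \<bar>n\<bar>) * character n x / of_nat N
        = of_real (fejer_weight N n) * character n x"
      by (simp only: times_divide_eq_left)
  qed
  finally show ?thesis .
qed

lemma fejer_kernel_measurable [measurable]: "fejer_kernel N \<in> borel_measurable borel"
  unfolding fejer_kernel_def by measurable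

lemma fejer_kernel_bounded: "fejer_kernel N x \<le> real N"
proof (cases "N = 0")
  case False
  have "cmod (\<Sum>j<N. character (int j) x) \<le> real N"
    using norm_sum[of "\<lambda>j. character (int j) x" "{..<N}"] by simp
  then have "(cmod (\<Sum>j<N. character (int j) x))\<^sup>2 \<le> (real N)\<^sup>2" by (rule power_mono) simp
  then show ?thesis using False by (simp add: fejer_kernel_def field_simps power2_eq_square)
qed (simp add: fejer_kernel_def)

lemma fejer_kernel_periodic: "fejer_kernel N (x + of_int k) = fejer_kernel N x"
  by (simp add: fejer_kernel_def character_add_arg)

lemma fejer_kernel_minus: "fejer_kernel N (- x) = fejer_kernel N x"
proof -
  have "cmod (\<Sum>j<N. character (int j) (- x)) = cmod (cnj (\<Sum>j<N. character (int j) x))"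
    unfolding cnj_sum character_minus_arg character_minus ..
  then show ?thesis unfolding fejer_kernel_def complex_mod_cnj by simp
qed

lemma integral_fejer_kernel:
  assumes "N > 0"
  shows "(\<integral>\<^sup>+y. ennreal (fejer_kernel N (y - u)) \<partial>torus) = 1"
proof -
  have m: "(\<lambda>y. fejer_kernel N (y - u)) \<in> borel_measurable borel" by measurable
  have int: "integrable torus (\<lambda>y. fejer_kernel N (y - u))"
    by (rule torus.integrable_const_bound[where B = "real N", OF _ borel_measurable_torus[OF m]])
      (simp add: fejer_kernel_nonneg fejer_kernel_bounded)
  have "complex_of_real (LINT y|torus. fejer_kernel N (y - u))
      = (LINT y|torus. complex_of_real (fejer_kernel N (y - u)))" by simp
  also have "\<dots> = (LINT y|torus. (\<Sum>n\<in>{-int N..int N}.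
      complex_of_real (fejer_weight N n) * (character n y * character n (-u))))"
    by (simp add: fejer_kernel_expansion[OF assms] flip: character_add_arg)
  also have "\<dots> = (\<Sum>n\<in>{-int N..int N}. complex_of_real (fejer_weight N n) *
      ((if n = 0 then 1 else 0) * character n (-u)))"
    by (subst Bochner_Integration.integral_sum)
       (auto simp only: integral_character integral_mult_right_zero integral_mult_left_zero
        intro!: integrable_mult_right integrable_mult_left integrable_character)
  also have "\<dots> = (\<Sum>n\<in>{-int N..int N}. (if n = 0 then 1 else 0))"
    by (intro sum.cong) (auto simp: fejer_weight_def)
  also have "\<dots> = 1" by simp
  finally have "(LINT y|torus. fejer_kernel N (y - u)) = 1"
    by (metis of_real_eq_1_iff)
  then show ?thesis using int
    by (subst nn_integral_eq_integral) (auto simp: fejer_kernel_nonneg)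
qed

lemma nn_integral_torus:
  assumes "u \<in> borel_measurable borel"
  shows "(\<integral>\<^sup>+x. u x \<partial>torus) = (\<integral>\<^sup>+x. u x * indicator {- 1 / 2 ..< 1 / 2} x \<partial>lborel)"
proof -
  have "(\<integral>\<^sup>+x. u x \<partial>torus) = (\<integral>\<^sup>+x. u x * indicator {- 1 / 2 ..< 1 / 2} x \<partial>lebesgue)"
    by (subst nn_integral_restrict_space) auto
  also have "\<dots> = (\<integral>\<^sup>+x. u x * indicator {- 1 / 2 ..< 1 / 2} x \<partial>lborel)"
    by (rule nn_integral_completion)
  finally show ?thesis .
qed

text \<open>The line is the disjoint union of the integer translates of the fundamental domain.\<close>

lemma nn_integral_blocks:
  assumes [measurable]: "u \<in> borel_measurable borel"
  shows "(\<integral>\<^sup>+x. u x \<partial>lborel)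
    = (\<integral>\<^sup>+k. \<integral>\<^sup>+t. u (of_int k + t) \<partial>torus \<partial>count_space UNIV)"
proof -
  have one: "(\<integral>\<^sup>+k. indicator {- 1 / 2 ..< 1 / 2} (x - of_int k) \<partial>count_space UNIV) = (1::ennreal)" for x :: real
  proof -
    have "(\<lambda>k::int. indicator {- 1 / 2 ..< 1 / 2 :: real} (x - of_int k) :: ennreal) = indicator {\<lfloor>x + 1/2\<rfloor>}"
      by (rule ext) (auto simp: indicator_def floor_eq_iff eq_commute[of _ "\<lfloor>x + 1/2\<rfloor>"])
    then show ?thesis by simp
  qed
  have "(\<integral>\<^sup>+x. u x \<partial>lborel)
     = (\<integral>\<^sup>+x. u x * (\<integral>\<^sup>+k. indicator {- 1 / 2 ..< 1 / 2} (x - of_int k) \<partial>count_space (UNIV :: int set)) \<partial>lborel)"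
    unfolding one by simp
  also have "\<dots> = (\<integral>\<^sup>+x. \<integral>\<^sup>+k. u x * indicator {- 1 / 2 ..< 1 / 2} (x - of_int k) \<partial>count_space (UNIV :: int set) \<partial>lborel)"
    by (simp add: nn_integral_cmult)
  also have "\<dots> = (\<integral>\<^sup>+k. \<integral>\<^sup>+x. u x * indicator {- 1 / 2 ..< 1 / 2} (x - of_int k) \<partial>lborel \<partial>count_space (UNIV :: int set))"
    by (rule nn_integral_count_space_nn_integral) auto
  also have "\<dots> = (\<integral>\<^sup>+k. \<integral>\<^sup>+t. u (of_int k + t) \<partial>torus \<partial>count_space UNIV)"
  proof (rule nn_integral_cong)
    fix k :: int
    have "(\<integral>\<^sup>+x. u x * indicator {- 1 / 2 ..< 1 / 2} (x - of_int k) \<partial>lborel)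
        = (\<integral>\<^sup>+t. u (of_int k + t) * indicator {- 1 / 2 ..< 1 / 2} t \<partial>lborel)"
      by (subst nn_integral_real_affine[where c = 1 and t = "of_int k"]) auto
    then show "(\<integral>\<^sup>+x. u x * indicator {- 1 / 2 ..< 1 / 2} (x - of_int k) \<partial>lborel)
        = (\<integral>\<^sup>+t. u (of_int k + t) \<partial>torus)"
      by (subst nn_integral_torus) auto
  qed
  finally show ?thesis .
qed

section \<open>Norms of blocks, limits and series\<close>

text \<open>Norms on the line are assembled from norms on the torus: for finite \<open>p\<close> the \<open>p\<close>-th powers of the
  block norms add up, and for \<open>p = \<infinity>\<close> one takes their supremum. Both are the norm of the sequence of
  block norms with respect to counting measure.\<close>

lemma Lp_norm_blocks:
  assumes p: "p = \<infinity> \<or> (\<exists>r>0. p = ennreal r)"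
    and [measurable]: "u \<in> borel_measurable borel"
    and block: "\<And>k. Lp_norm p torus (\<lambda>t. u (of_int k + t)) \<le> ennreal (x k)"
    and x: "\<And>k. x k \<ge> 0" and X: "X \<ge> 0"
    and sum: "Lp_norm p (count_space UNIV) (\<lambda>k. complex_of_real (x k)) \<le> ennreal X"
  shows "Lp_norm p lebesgue u \<le> ennreal X"
  using p
proof
  assume p: "p = \<infinity>"
  have "AE k in count_space (UNIV :: int set). cmod (complex_of_real (x k)) \<le> X"
    using sum X by (intro Lp_norm_infinity_AE) (auto simp: p)
  then have xX: "x k \<le> X" for k using x by (simp add: AE_count_space)
  \<comment> \<open>The set where \<open>u\<close> exceeds \<open>X\<close> is null because it is null on every block.\<close>
  have bad: "(\<integral>\<^sup>+t. indicator {y. cmod (u y) > X} (of_int k + t) \<partial>torus) = 0" for k :: int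
  proof -
    have "AE t in torus. cmod (u (of_int k + t)) \<le> x k"
      using block[of k] x by (intro Lp_norm_infinity_AE) (auto simp: p)
    then have "(\<integral>\<^sup>+t. indicator {y. cmod (u y) > X} (of_int k + t) \<partial>torus) = (\<integral>\<^sup>+t. 0 \<partial>torus)"
      using xX[of k] by (intro nn_integral_cong_AE) (auto simp: indicator_def elim!: eventually_mono)
    then show ?thesis by simp
  qed
  have "(\<integral>\<^sup>+y. indicator {y. cmod (u y) > X} y \<partial>lborel) = 0"
    by (subst nn_integral_blocks, measurable) (simp only: bad nn_integral_const mult_zero_left)
  then have "AE y in lborel. indicator {y. cmod (u y) > X} y = (0::ennreal)"
    by (subst (asm) nn_integral_0_iff_AE) auto
  then have "AE y in lebesgue. cmod (u y) \<le> X"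
    by (intro AE_completion) (auto simp: indicator_def not_less elim!: eventually_mono split: if_splits)
  then show ?thesis
    unfolding p by (intro Lp_norm_infinity_leI measurable_completion) auto
next
  assume "\<exists>r>0. p = ennreal r"
  then obtain r where r: "r > 0" "p = ennreal r" by blast
  have "(\<integral>\<^sup>+y. ennreal (cmod (u y) powr r) \<partial>lebesgue) = (\<integral>\<^sup>+y. ennreal (cmod (u y) powr r) \<partial>lborel)"
    by (rule nn_integral_completion)
  also have "\<dots> = (\<integral>\<^sup>+k. \<integral>\<^sup>+t. ennreal (cmod (u (of_int k + t)) powr r) \<partial>torus \<partial>count_space (UNIV :: int set))"
    by (rule nn_integral_blocks) measurable
  also have "\<dots> \<le> (\<integral>\<^sup>+k. ennreal (x k powr r) \<partial>count_space (UNIV :: int set))"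
    using block r x by (intro nn_integral_mono) (auto simp: Lp_norm_le_iff)
  also have "\<dots> \<le> ennreal (X powr r)"
    using sum r x X by (auto simp: Lp_norm_le_iff)
  finally show ?thesis using r X by (simp add: Lp_norm_le_iff)
qed

lemma Lp_norm_Fatou:
  assumes p: "p = \<infinity> \<or> (\<exists>r>0. p = ennreal r)"
    and m[measurable]: "\<And>n. u n \<in> borel_measurable M"
    and lim: "\<And>x. (\<lambda>n. u n x) \<longlonglongrightarrow> v x"
    and le: "\<And>n. Lp_norm p M (u n) \<le> ennreal X" and X: "X \<ge> 0"
  shows "Lp_norm p M v \<le> ennreal X"
  using p
proof
  have v: "v \<in> borel_measurable M" by (rule borel_measurable_LIMSEQ_metric[OF m lim])
  assume p: "p = \<infinity>"
  have "AE x in M. \<forall>n. cmod (u n x) \<le> X"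
    unfolding AE_all_countable using le X by (auto intro!: Lp_norm_infinity_AE simp: p)
  then have "AE x in M. cmod (v x) \<le> X"
    by eventually_elim (use lim in \<open>auto intro!: Lim_norm_ubound[OF _ lim]\<close>)
  then show ?thesis using v by (simp only: p Lp_norm_infinity_leI)
next
  assume "\<exists>r>0. p = ennreal r"
  then obtain r where r: "r > 0" "p = ennreal r" by blast
  have "(\<lambda>n. ennreal (cmod (u n x) powr r)) \<longlonglongrightarrow> ennreal (cmod (v x) powr r)" for x
    using r by (intro tendsto_ennrealI tendsto_powr' tendsto_norm lim tendsto_const) auto
  then have "(\<integral>\<^sup>+x. ennreal (cmod (v x) powr r) \<partial>M)
      = (\<integral>\<^sup>+x. liminf (\<lambda>n. ennreal (cmod (u n x) powr r)) \<partial>M)"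
    by (intro nn_integral_cong lim_imp_Liminf[symmetric]) auto
  also have "\<dots> \<le> liminf (\<lambda>n. \<integral>\<^sup>+x. ennreal (cmod (u n x) powr r) \<partial>M)"
    by (rule nn_integral_liminf) measurable
  also have "\<dots> \<le> limsup (\<lambda>n. \<integral>\<^sup>+x. ennreal (cmod (u n x) powr r) \<partial>M)"
    by (rule Liminf_le_Limsup) simp
  also have "\<dots> \<le> ennreal (X powr r)"
    using le r X by (intro Limsup_bounded) (auto simp: Lp_norm_le_iff)
  finally show ?thesis using r X by (simp add: Lp_norm_le_iff)
qed

text \<open>A substitute for the triangle inequality that is valid for every exponent, including the
  quasinorm range. A double series whose terms satisfy \<open>2 ^ (a + b) * |v a b x| \<le> S\<close> is at most \<open>4 * S\<close>, so its
  \<open>r\<close>-th power is dominated pointwise by the sum of the \<open>r\<close>-th powers of \<open>4 * 2 ^ (a + b) * v a b\<close>,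
  for every \<open>r > 0\<close>. The price is the factor \<open>2 ^ (a + b)\<close>, which a decay like \<open>4 ^ - (a + b)\<close> of the norms absorbs.\<close>

lemma Lp_norm_double_series:
  assumes p: "p = \<infinity> \<or> (\<exists>r>0. p = ennreal r)"
  obtains Q :: real where "Q > 0"
    "\<And>(M :: 'a measure) u v D. (\<And>a b. v a b \<in> borel_measurable M) \<Longrightarrow> u \<in> borel_measurable M \<Longrightarrow> D \<ge> 0 \<Longrightarrow>
      (\<And>x S. (\<And>a b :: nat. 2 ^ (a + b) * cmod (v a b x) \<le> S) \<Longrightarrow> cmod (u x) \<le> 4 * S) \<Longrightarrow>
      (\<And>a b. Lp_norm p M (v a b) \<le> ennreal (D * (1 / 4) ^ (a + b))) \<Longrightarrow>
      Lp_norm p M u \<le> ennreal (Q * D)"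
  using p
proof
  assume p: "p = \<infinity>"
  show thesis
  proof (rule that[of 4])
    fix M :: "'a measure" and u :: "'a \<Rightarrow> complex" and v :: "nat \<Rightarrow> nat \<Rightarrow> 'a \<Rightarrow> complex" and D :: real
    assume h: "\<And>a b. v a b \<in> borel_measurable M" "u \<in> borel_measurable M" "D \<ge> 0"
      and uv: "\<And>x S. (\<And>a b :: nat. 2 ^ (a + b) * cmod (v a b x) \<le> S) \<Longrightarrow> cmod (u x) \<le> 4 * S"
      and v: "\<And>a b. Lp_norm p M (v a b) \<le> ennreal (D * (1 / 4) ^ (a + b))"
    have "AE x in M. \<forall>a. \<forall>b. cmod (v a b x) \<le> D * (1 / 4) ^ (a + b)"
      unfolding AE_all_countable using v h(3) by (auto intro!: Lp_norm_infinity_AE simp: p)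
    then have "AE x in M. cmod (u x) \<le> 4 * D"
    proof eventually_elim
      case (elim x)
      show ?case
      proof (rule uv)
        fix a b
        have "2 ^ (a + b) * cmod (v a b x) \<le> 2 ^ (a + b) * (D * (1 / 4) ^ (a + b))"
          using elim by (intro mult_left_mono) auto
        also have "\<dots> = D * (1 / 2) ^ (a + b)"
          by (simp add: power_divide power_mult_distrib[symmetric] field_simps flip: power_mult_distrib)
        also have "\<dots> \<le> D" using h(3) by (intro mult_left_le) (auto simp: power_le_one)
        finally show "2 ^ (a + b) * cmod (v a b x) \<le> D" .
      qed
    qed
    then show "Lp_norm p M u \<le> ennreal (4 * D)" using h unfolding p by (intro Lp_norm_infinity_leI)
  qed simp
next
  assume "\<exists>r>0. p = ennreal r"
  then obtain r where r: "r > 0" "p = ennreal r" by blast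
  define q where "q = (1 / 2 :: real) powr r"
  have q: "0 \<le> q" "q < 1" using r using powr_less_mono2[of r "1 / 2" 1] by (auto simp: q_def)
  define G where "G = 1 / (1 - q)"
  have G: "G > 0" using q by (simp add: G_def)
  show thesis
  proof (rule that[of "4 * (G\<^sup>2) powr (1 / r)"])
    fix M :: "'a measure" and u :: "'a \<Rightarrow> complex" and v :: "nat \<Rightarrow> nat \<Rightarrow> 'a \<Rightarrow> complex" and D :: real
    assume h[measurable]: "\<And>a b. v a b \<in> borel_measurable M" "u \<in> borel_measurable M" and D: "D \<ge> 0"
      and uv: "\<And>x S. (\<And>a b :: nat. 2 ^ (a + b) * cmod (v a b x) \<le> S) \<Longrightarrow> cmod (u x) \<le> 4 * S"
      and v: "\<And>a b. Lp_norm p M (v a b) \<le> ennreal (D * (1 / 4) ^ (a + b))"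
    define w where "w a b x = ennreal ((4 * 2 ^ (a + b)) powr r) * ennreal (cmod (v a b x) powr r)" for a b x
    have [measurable]: "w a b \<in> borel_measurable M" for a b unfolding w_def by measurable
    have ptw: "ennreal (cmod (u x) powr r) \<le> (\<Sum>a. \<Sum>b. w a b x)" for x
    proof (cases "\<Sum>a. \<Sum>b. w a b x")
      case (real s)
      have "cmod (u x) \<le> 4 * (s powr (1 / r) / 4)"
      proof (rule uv)
        fix a b
        have "w a b x \<le> (\<Sum>b. w a b x)"
          using sum_le_suminf[of "\<lambda>b. w a b x" "{b}"] by simp
        also have "\<dots> \<le> (\<Sum>a. \<Sum>b. w a b x)"
          using sum_le_suminf[of "\<lambda>a. \<Sum>b. w a b x" "{a}"] by simp
        finally have "(4 * 2 ^ (a + b)) powr r * cmod (v a b x) powr r \<le> s"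
          using real by (simp add: w_def flip: ennreal_mult)
        then have "(4 * 2 ^ (a + b) * cmod (v a b x)) powr r \<le> s" by (simp add: powr_mult)
        then have "((4 * 2 ^ (a + b) * cmod (v a b x)) powr r) powr (1 / r) \<le> s powr (1 / r)"
          using r by (intro powr_mono2) auto
        then have "4 * 2 ^ (a + b) * cmod (v a b x) \<le> s powr (1 / r)"
          using r by (simp add: powr_powr)
        then show "2 ^ (a + b) * cmod (v a b x) \<le> s powr (1 / r) / 4" by simp
      qed
      then have "cmod (u x) powr r \<le> (s powr (1 / r)) powr r"
        using r by (intro powr_mono2) auto
      then have "cmod (u x) powr r \<le> s" using r real by (simp add: powr_powr)
      then show ?thesis using real by (simp add: ennreal_leI)
    qed simp
    have int_w: "(\<integral>\<^sup>+x. w a b x \<partial>M) \<le> ennreal ((4 * D) powr r) * ennreal (q ^ a) * ennreal (q ^ b)" for a b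
    proof -
      have "(\<integral>\<^sup>+x. w a b x \<partial>M) = ennreal ((4 * 2 ^ (a + b)) powr r) * (\<integral>\<^sup>+x. ennreal (cmod (v a b x) powr r) \<partial>M)"
        unfolding w_def by (rule nn_integral_cmult) simp
      also have "\<dots> \<le> ennreal ((4 * 2 ^ (a + b)) powr r) * ennreal ((D * (1 / 4) ^ (a + b)) powr r)"
        using v r D by (intro mult_left_mono) (auto simp: Lp_norm_le_iff)
      also have "\<dots> = ennreal (((4 * 2 ^ (a + b)) * (D * (1 / 4) ^ (a + b))) powr r)"
        using D by (subst powr_mult) (auto simp: ennreal_mult)
      also have "(4 * 2 ^ (a + b)) * (D * (1 / 4) ^ (a + b)) = 4 * D * ((1 / 2) ^ a * (1 / 2) ^ b)"
      proof -
        have "(2::real) ^ (a + b) * (1 / 4) ^ (a + b) = (1 / 2) ^ (a + b)"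
          by (subst power_mult_distrib[symmetric]) simp
        then show ?thesis by (simp add: power_add)
      qed
      also have "(4 * D * ((1 / 2) ^ a * (1 / 2) ^ b)) powr r = (4 * D) powr r * q ^ a * q ^ b"
        using D by (simp add: q_def powr_mult powr_powr mult.commute flip: powr_realpow)
      finally show ?thesis using q by (simp add: ennreal_mult)
    qed
    have "(\<integral>\<^sup>+x. ennreal (cmod (u x) powr r) \<partial>M) \<le> (\<integral>\<^sup>+x. (\<Sum>a. \<Sum>b. w a b x) \<partial>M)"
      by (intro nn_integral_mono ptw)
    also have "\<dots> = (\<Sum>a. \<Sum>b. \<integral>\<^sup>+x. w a b x \<partial>M)"
      by (simp add: nn_integral_suminf)
    also have "\<dots> \<le> (\<Sum>a. \<Sum>b. ennreal ((4 * D) powr r) * ennreal (q ^ a) * ennreal (q ^ b))"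
      by (intro suminf_le int_w) auto
    also have "\<dots> = ennreal ((4 * D) powr r) * (\<Sum>n. ennreal (q ^ n)) * (\<Sum>n. ennreal (q ^ n))"
      by (simp only: ennreal_suminf_cmult ennreal_suminf_multc)
    also have "(\<Sum>n. ennreal (q ^ n)) = ennreal G"
      unfolding G_def using q by (intro suminf_ennreal_eq geometric_sums) auto
    also have "ennreal ((4 * D) powr r) * ennreal G * ennreal G = ennreal ((4 * (G\<^sup>2) powr (1 / r) * D) powr r)"
    proof -
      have "((G\<^sup>2) powr (1 / r)) powr r = G * G"
        using G r by (simp only: powr_powr) (simp add: power2_eq_square)
      then have "(4 * (G\<^sup>2) powr (1 / r) * D) powr r = (4 * D) powr r * G * G"
        using D by (simp add: powr_mult)
      then show ?thesis using G by (simp add: ennreal_mult)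
    qed
    finally show "Lp_norm p M u \<le> ennreal (4 * (G\<^sup>2) powr (1 / r) * D)"
      using r D by (simp add: Lp_norm_le_iff)
  qed (use G in auto)
qed

section \<open>A decaying weight and its lattice sums\<close>

text \<open>An integrable majorant, up to constants, of the convolution kernels below.\<close>

definition decay :: "real \<Rightarrow> real" where
  "decay x = 1 / (1 + x\<^sup>2)"

lemma decay_measurable [measurable]: "decay \<in> borel_measurable borel"
  unfolding decay_def by measurable

lemma decay_pos: "decay x > 0"
  by (simp add: decay_def add_pos_nonneg)

lemma decay_nonneg [simp]: "0 \<le> decay x"
  by (rule less_imp_le[OF decay_pos])

lemma decay_le_1: "decay x \<le> 1"
  by (simp add: decay_def add_pos_nonneg divide_le_eq)

lemma decay_minus [simp]: "decay (- x) = decay x"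
  by (simp add: decay_def)

lemma integrable_decay: "integrable lborel decay"
  using integrable_inverse_1_plus_square
  by (simp add: set_integrable_def decay_def[abs_def] inverse_eq_divide)

text \<open>The constant that bounds all the lattice sums of \<^const>\<open>decay\<close>.\<close>

definition decay_mass :: real where
  "decay_mass = 2 * (LINT x|lborel. decay x)"

lemma decay_mass_pos: "decay_mass > 0"
proof -
  have "(LINT x|lborel. decay x) \<noteq> 0"
  proof
    assume "(LINT x|lborel. decay x) = 0"
    then have "AE x in lborel. decay x = 0"
      using integrable_decay decay_pos by (subst (asm) integral_nonneg_eq_0_iff_AE) (auto intro: less_imp_le)
    then have "AE x in (lborel :: real measure). False"
      by eventually_elim (metis decay_pos less_irrefl)
    then show False by (simp add: trivial_limit_def[symmetric] ae_filter_eq_bot_iff)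
  qed
  moreover have "(LINT x|lborel. decay x) \<ge> 0"
    by (intro Bochner_Integration.integral_nonneg less_imp_le decay_pos)
  ultimately show ?thesis unfolding decay_mass_def by linarith
qed

lemma decay_shift:
  assumes "\<bar>t\<bar> \<le> 1 / 2"
  shows "decay x \<le> 2 * decay (x + t)"
proof -
  have "t\<^sup>2 \<le> 1 / 4"
    using power_mono[OF assms, of 2] by (simp add: power_divide)
  moreover have "(x + t)\<^sup>2 \<le> 2 * x\<^sup>2 + 2 * t\<^sup>2"
    using sum_squares_bound[of x t] by (simp add: power2_sum)
  ultimately have "1 + (x + t)\<^sup>2 \<le> 2 * (1 + x\<^sup>2)" by (simp add: distrib_left)
  then show ?thesis by (simp add: decay_def field_simps add_pos_nonneg)
qed

text \<open>Up to a factor 2 the weight at \<open>k - u\<close> is at most its average over the unit interval around that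
  point, so that a lattice sum is bounded by the integral over the line.\<close>

lemma sum_decay_le:
  "(\<integral>\<^sup>+k. ennreal (decay (of_int k - u)) \<partial>count_space UNIV) \<le> ennreal decay_mass"
proof -
  have "(\<integral>\<^sup>+k. ennreal (decay (of_int k - u)) \<partial>count_space UNIV)
      = (\<integral>\<^sup>+k. \<integral>\<^sup>+t. ennreal (decay (of_int k - u)) \<partial>torus \<partial>count_space UNIV)"
    using torus.emeasure_space_1 by (simp del: space_restrict_space)
  also have "\<dots> \<le> (\<integral>\<^sup>+k. \<integral>\<^sup>+t. ennreal (2 * decay (of_int k + t - u)) \<partial>torus \<partial>count_space UNIV)"
  proof (intro nn_integral_mono ennreal_leI)
    fix k t assume "t \<in> space torus"
    then have "\<bar>t\<bar> \<le> 1 / 2" by (auto simp: abs_le_iff)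
    from decay_shift[OF this, of "of_int k - u"]
    show "decay (of_int k - u) \<le> 2 * decay (of_int k + t - u)" by (simp add: algebra_simps)
  qed
  also have "\<dots> = (\<integral>\<^sup>+x. ennreal (2 * decay (x - u)) \<partial>lborel)"
    by (rule nn_integral_blocks[symmetric]) measurable
  also have "\<dots> = (\<integral>\<^sup>+x. ennreal (2 * decay x) \<partial>lborel)"
    by (subst nn_integral_real_affine[where c = 1 and t = u]) auto
  also have "\<dots> = ennreal (LINT x|lborel. 2 * decay x)"
    using integrable_decay by (intro nn_integral_eq_integral) (auto intro: less_imp_le decay_pos)
  finally show ?thesis by (simp add: decay_mass_def)
qed

section \<open>Moments of the triangle function\<close>

text \<open>The one-dimensional factor of \<^const>\<open>tent\<close>.\<close>

definition tri :: "real \<Rightarrow> real" where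
  "tri s = max 0 (1 - \<bar>s\<bar>)"

lemma tri_measurable [measurable]: "tri \<in> borel_measurable borel"
  unfolding tri_def by measurable

lemma tri_nonneg: "tri s \<ge> 0" and tri_le_1: "tri s \<le> 1"
  by (auto simp: tri_def)

lemma tri_eq_0: "\<bar>s\<bar> \<ge> 1 \<Longrightarrow> tri s = 0"
  by (auto simp: tri_def)

lemma tri_power_le_1: "\<bar>tri s * s ^ a\<bar> \<le> 1"
proof (cases "\<bar>s\<bar> \<le> 1")
  case True
  then show ?thesis
    using tri_nonneg[of s] tri_le_1[of s]
    by (simp add: abs_mult power_abs mult_le_one power_le_one)
qed (simp add: tri_eq_0)

text \<open>The inverse Fourier transform of \<open>tri s * s ^ a\<close>. These are the convolution kernels that appear
  when the phase \<open>cis (2 * pi * t * s)\<close> is expanded into a power series in \<open>t\<close>; for \<open>a = 0\<close> this is the Fejer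
  kernel of the line.\<close>

definition tri_moment :: "nat \<Rightarrow> real \<Rightarrow> complex" where
  "tri_moment a u = (LINT s|lborel. of_real (tri s * s ^ a) * cis (2 * pi * u * s))"

definition osc :: "nat \<Rightarrow> real \<Rightarrow> complex" where
  "osc a l = integral {0..1} (\<lambda>s. of_real (s ^ a) * cis (l * s))"

lemma osc_integrable: "(\<lambda>s. of_real (s ^ a) * cis (l * s)) integrable_on {0..1}"
  by (intro integrable_continuous_real continuous_intros)

lemma norm_osc_le_1: "cmod (osc a l) \<le> 1"
proof -
  have "cmod (osc a l) \<le> integral {0..1} (\<lambda>s::real. 1)"
    unfolding osc_def
    by (intro integral_norm_bound_integral osc_integrable)
       (auto simp: norm_mult norm_power power_le_one)
  then show ?thesis by simp
qed

lemma osc_by_parts: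
  "\<i> * of_real l * osc (Suc a) l = cis l - of_nat (Suc a) * osc a l"
proof -
  have "((\<lambda>s. of_nat (Suc a) * (of_real (s ^ a) * cis (l * s)) + \<i> * of_real l * (of_real (s ^ Suc a) * cis (l * s)))
      has_integral (of_real (1 ^ Suc a) * cis (l * 1) - of_real (0 ^ Suc a) * cis (l * 0))) {0..1}"
  proof (rule fundamental_theorem_of_calculus)
    fix x :: real
    have "((\<lambda>s. complex_of_real (s ^ Suc a)) has_vector_derivative of_real (real (Suc a) * x ^ a)) (at x within {0..1})"
      by (rule has_vector_derivative_of_real, rule DERIV_cong[OF DERIV_power[OF DERIV_ident]]) simp
    from has_vector_derivative_mult[OF this has_vector_derivative_cis[of l]]
    show "((\<lambda>s. complex_of_real (s ^ Suc a) * cis (l * s)) has_vector_derivative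
       of_nat (Suc a) * (of_real (x ^ a) * cis (l * x)) + \<i> * of_real l * (of_real (x ^ Suc a) * cis (l * x)))
       (at x within {0..1})"
      by (rule has_vector_derivative_eq_rhs) (simp add: algebra_simps)
  qed simp
  then have "((\<lambda>s. of_nat (Suc a) * (of_real (s ^ a) * cis (l * s)) + \<i> * of_real l * (of_real (s ^ Suc a) * cis (l * s)))
      has_integral cis l) {0..1}" by simp
  moreover have "((\<lambda>s. of_nat (Suc a) * (of_real (s ^ a) * cis (l * s)) + \<i> * of_real l * (of_real (s ^ Suc a) * cis (l * s)))
      has_integral (of_nat (Suc a) * osc a l + \<i> * of_real l * osc (Suc a) l)) {0..1}"
    unfolding osc_def
    by (intro has_integral_add has_integral_mult_right integrable_integral osc_integrable)
  ultimately have "cis l = of_nat (Suc a) * osc a l + \<i> * of_real l * osc (Suc a) l"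
    by (rule has_integral_unique)
  then show ?thesis by simp
qed

lemma osc_0: "\<i> * of_real l * osc 0 l = cis l - 1"
proof -
  have "((\<lambda>s. \<i> * of_real l * cis (l * s)) has_integral (cis (l * 1) - cis (l * 0))) {0..1}"
    by (rule fundamental_theorem_of_calculus) (auto intro: has_vector_derivative_cis)
  moreover have "((\<lambda>s. \<i> * of_real l * (of_real (s ^ 0) * cis (l * s))) has_integral (\<i> * of_real l * osc 0 l)) {0..1}"
    unfolding osc_def by (intro has_integral_mult_right integrable_integral osc_integrable)
  ultimately show ?thesis by (auto dest: has_integral_unique)
qed

text \<open>Two integrations by parts. On \<open>[0, 1]\<close> the function \<open>s ^ a - s ^ Suc a\<close> vanishes at both end
  points, with the exception of the value 1 at the point 0 if \<open>a = 0\<close>. The term subtracted on the left is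
  that boundary contribution; it is odd in \<open>l\<close> and cancels against the one from \<open>[-1, 0]\<close>.\<close>

lemma osc_diff_decay:
  "cmod (- (of_real l)\<^sup>2 * (osc a l - osc (Suc a) l) - (if a = 0 then - \<i> * of_real l else 0))
    \<le> 4 * (real a + 1)\<^sup>2"
proof (cases a)
  case 0
  have "\<i> * of_real l * (osc 0 l - osc (Suc 0) l) = - 1 + osc 0 l"
    using osc_0[of l] osc_by_parts[of l 0] by (simp add: right_diff_distrib)
  then have "\<i> * of_real l * (\<i> * of_real l * (osc 0 l - osc (Suc 0) l))
      = - \<i> * of_real l + (cis l - 1)"
    by (simp only: distrib_left osc_0) simp
  then have "- (of_real l)\<^sup>2 * (osc 0 l - osc (Suc 0) l) - (- \<i> * of_real l) = cis l - 1"
    by (simp add: power2_eq_square algebra_simps)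
  then show ?thesis
    using norm_triangle_ineq4[of "cis l" 1] 0 by simp
next
  case (Suc b)
  define il where "il = \<i> * complex_of_real l"
  have il2: "il * il = - (of_real l)\<^sup>2"
    unfolding il_def power2_eq_square[symmetric] power_mult_distrib by simp
  have il_bound: "cmod (il * osc c l) \<le> 1 + real c + 1" for c
  proof (cases c)
    case 0
    then show ?thesis using norm_triangle_ineq4[of "cis l" 1] by (simp add: il_def osc_0)
  next
    case (Suc d)
    have "cmod (il * osc c l) = cmod (cis l - of_nat (Suc d) * osc d l)"
      unfolding il_def Suc osc_by_parts ..
    also have "\<dots> \<le> 1 + cmod (of_nat (Suc d) * osc d l)"
      using norm_triangle_ineq4[of "cis l"] by simp
    also have "cmod (of_nat (Suc d) * osc d l) \<le> real (Suc d) * 1"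
      unfolding norm_mult by (intro mult_mono norm_osc_le_1) (auto simp: norm_of_nat simp del: of_nat_Suc)
    finally show ?thesis using Suc by simp
  qed
  have e: "il * (osc a l - osc (Suc a) l) = of_nat (Suc a) * osc a l - of_nat a * osc b l"
    using osc_by_parts[of l b] osc_by_parts[of l a] unfolding Suc il_def
    by (simp add: right_diff_distrib del: of_nat_Suc)
  have "- (of_real l)\<^sup>2 * (osc a l - osc (Suc a) l) = il * (il * (osc a l - osc (Suc a) l))"
    
    by (simp only: mult.assoc[symmetric] il2)
  also have "\<dots> = of_nat (Suc a) * (il * osc a l) - of_nat a * (il * osc b l)"
    unfolding e by (simp add: algebra_simps)
  finally have "cmod (- (of_real l)\<^sup>2 * (osc a l - osc (Suc a) l))
      \<le> cmod (of_nat (Suc a) * (il * osc a l)) + cmod (of_nat a * (il * osc b l))"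
    using norm_triangle_ineq4 by metis
  also have "\<dots> \<le> real (Suc a) * (1 + real a + 1) + real a * (1 + real b + 1)"
    unfolding norm_mult[of "of_nat _"] norm_of_nat
    by (intro add_mono mult_left_mono il_bound) auto
  also have "\<dots> \<le> 4 * (real a + 1)\<^sup>2"
    using Suc by (simp add: power2_eq_square algebra_simps)
  finally show ?thesis using Suc by simp
qed

lemma norm_tri_power_cis_le: "cmod (of_real (tri s * s ^ a) * cis t) \<le> indicator {-1..1} s"
proof (cases "s \<in> {-1..1}")
  case True
  then show ?thesis using tri_power_le_1[of s a]
    unfolding norm_mult norm_of_real norm_cis by simp
next
  case False
  then have "\<bar>s\<bar> \<ge> 1" by auto
  then show ?thesis using False by (simp add: tri_eq_0)
qed

lemma tri_integrable: "integrable lborel (\<lambda>s. of_real (tri s * s ^ a) * cis (l * s) :: complex)"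
proof (rule Bochner_Integration.integrable_bound)
  show "integrable lborel (\<lambda>s::real. indicator {-1..1} s :: real)" by simp
  show "AE s in lborel. cmod (of_real (tri s * s ^ a) * cis (l * s)) \<le> norm (indicator {-1..1} s :: real)"
  proof (rule AE_I2)
    fix s :: real
    show "cmod (of_real (tri s * s ^ a) * cis (l * s)) \<le> norm (indicator {-1..1} s :: real)"
      using norm_tri_power_cis_le[of s a "l * s"] by simp
  qed
  show "(\<lambda>s. of_real (tri s * s ^ a) * cis (l * s) :: complex) \<in> borel_measurable lborel"
    unfolding cis_conv_exp by measurable
qed

lemma tri_half:
  "((\<lambda>s. of_real (tri s * s ^ a) * cis (l * s)) has_integral (osc a l - osc (Suc a) l)) {0..1}"
proof -
  have "((\<lambda>s. of_real (s ^ a) * cis (l * s) - of_real (s ^ Suc a) * cis (l * s)) has_integral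
    (osc a l - osc (Suc a) l)) {0..1}"
    unfolding osc_def by (intro has_integral_diff integrable_integral osc_integrable)
  then show ?thesis
    by (rule has_integral_eq[rotated]) (auto simp: tri_def algebra_simps)
qed

lemma tri_moment_osc:
  "tri_moment a u = (osc a (2 * pi * u) - osc (Suc a) (2 * pi * u))
     + (- 1) ^ a * (osc a (- (2 * pi * u)) - osc (Suc a) (- (2 * pi * u)))"
proof -
  define l where "l = 2 * pi * u"
  let ?h = "\<lambda>l s. complex_of_real (tri s * s ^ a) * cis (l * s)"
  have eq: "(- 1) ^ a * ?h (- l) (- s) = ?h l s" for s
  proof -
    have "(- 1) ^ a * ?h (- l) (- s) = of_real ((- 1) ^ a * (tri (- s) * (- s) ^ a)) * cis (l * s)"
      by simp
    also have "(- 1) ^ a * (tri (- s) * (- s) ^ a) = tri s * ((- 1) * (- s)) ^ a"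
      unfolding power_mult_distrib by (simp add: tri_def)
    finally show ?thesis by simp
  qed
  have "((\<lambda>s. (- 1) ^ a * ?h (- l) s) has_integral (- 1) ^ a * (osc a (- l) - osc (Suc a) (- l))) {0..1}"
    by (intro has_integral_mult_right tri_half)
  then have "((\<lambda>s. (- 1) ^ a * ?h (- l) (- s)) has_integral (- 1) ^ a * (osc a (- l) - osc (Suc a) (- l))) {-1..-0}"
    by (rule has_integral_reflect_real[THEN iffD2])
  then have "(?h l has_integral (- 1) ^ a * (osc a (- l) - osc (Suc a) (- l))) {-1..0}"
    unfolding eq by (simp only: minus_zero)
  from has_integral_combine[OF _ _ this tri_half[of a l]]
  have "(?h l has_integral (- 1) ^ a * (osc a (- l) - osc (Suc a) (- l)) + (osc a l - osc (Suc a) l)) {-1..1}"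
    by simp
  then have "(?h l has_integral (- 1) ^ a * (osc a (- l) - osc (Suc a) (- l)) + (osc a l - osc (Suc a) l)) UNIV"
    by (rule has_integral_on_superset) (auto simp: tri_eq_0)
  moreover have "(?h l has_integral tri_moment a u) UNIV"
    using has_integral_integral_lborel[OF tri_integrable[of a l]] by (simp add: tri_moment_def l_def)
  ultimately have "tri_moment a u = (- 1) ^ a * (osc a (- l) - osc (Suc a) (- l)) + (osc a l - osc (Suc a) l)"
    by (rule has_integral_unique[rotated])
  then show ?thesis by (simp only: l_def add.commute)
qed

lemma tri_moment_bound_1: "cmod (tri_moment a u) \<le> 2"
proof -
  let ?f = "\<lambda>s. complex_of_real (tri s * s ^ a) * cis (2 * pi * u * s)"
  have "cmod (tri_moment a u) \<le> (LINT s|lborel. cmod (?f s))"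
    unfolding tri_moment_def by (rule integral_norm_bound)
  also have "\<dots> \<le> (LINT s|lborel. indicator {-1..1::real} s)"
  proof (rule integral_mono)
    show "integrable lborel (\<lambda>s. cmod (?f s))" by (intro integrable_norm tri_integrable)
    show "integrable lborel (indicator {-1..1::real} :: real \<Rightarrow> real)" by simp
    show "cmod (?f s) \<le> indicator {-1..1} s" for s by (rule norm_tri_power_cis_le)
  qed
  finally show ?thesis by simp
qed

text \<open>The growth in \<open>a\<close> is harmless because \<open>tri_moment a\<close> will come with a factor
  \<open>pi ^ a / fact a\<close>. What is essential is the integrable decay in \<open>u\<close>, uniformly up to this growth; it
  comes from the continuity of the triangle function.\<close>

lemma tri_moment_decay: "cmod (tri_moment a u) \<le> 10 * 4 ^ a * decay u"
proof -
  define l where "l = 2 * pi * u"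
  define d where "d = (\<lambda>l. osc a l - osc (Suc a) l)"
  define j where "j = (\<lambda>l. if a = 0 then - \<i> * complex_of_real l else 0)"
  \<comment> \<open>The contributions of the corner of the triangle at 0 from both sides cancel.\<close>
  have jj: "j l + (- 1) ^ a * j (- l) = 0" by (simp add: j_def)
  have "- (of_real l)\<^sup>2 * tri_moment a u = (- (of_real l)\<^sup>2 * d l - j l) + (- 1) ^ a * (- (of_real (- l))\<^sup>2 * d (- l) - j (- l))"
    using jj unfolding tri_moment_osc l_def[symmetric] d_def by (simp add: algebra_simps)
  then have "cmod (- (of_real l)\<^sup>2 * tri_moment a u) \<le> cmod (- (of_real l)\<^sup>2 * d l - j l) + cmod (- (of_real (- l))\<^sup>2 * d (- l) - j (- l))"
    using norm_triangle_ineq[of "- (of_real l)\<^sup>2 * d l - j l" "(- 1) ^ a * (- (of_real (- l))\<^sup>2 * d (- l) - j (- l))"]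
    by (simp add: norm_mult norm_power)
  also have "\<dots> \<le> 4 * (real a + 1)\<^sup>2 + 4 * (real a + 1)\<^sup>2"
    unfolding d_def j_def by (intro add_mono osc_diff_decay)
  also have "(real a + 1)\<^sup>2 \<le> 4 ^ a"
  proof -
    have "real a + 1 \<le> 2 ^ a" by (induction a) auto
    then have "(real a + 1)\<^sup>2 \<le> (2 ^ a)\<^sup>2" by (rule power_mono) simp
    also have "(2 ^ a)\<^sup>2 = (4::real) ^ a" 
      by (simp add: power2_eq_square flip: power_mult_distrib)
    finally show ?thesis .
  qed
  finally have "l\<^sup>2 * cmod (tri_moment a u) \<le> 8 * 4 ^ a"
    by (simp add: norm_mult norm_power)
  moreover have "u\<^sup>2 \<le> l\<^sup>2"
  proof -
    have "1 * \<bar>u\<bar> \<le> (2 * pi) * \<bar>u\<bar>"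
      using pi_ge_two by (intro mult_right_mono) auto
    then have "\<bar>u\<bar> \<le> \<bar>l\<bar>" by (simp add: l_def abs_mult)
    then show ?thesis by (simp add: abs_le_square_iff)
  qed
  ultimately have "u\<^sup>2 * cmod (tri_moment a u) \<le> 8 * 4 ^ a"
    by (meson mult_right_mono norm_ge_zero order_trans)
  moreover have "cmod (tri_moment a u) \<le> 2 * 4 ^ a"
    using tri_moment_bound_1[of a u] by (rule order_trans) simp
  ultimately have "(1 + u\<^sup>2) * cmod (tri_moment a u) \<le> 10 * 4 ^ a"
    by (simp add: distrib_right)
  then show ?thesis
    by (simp add: decay_def field_simps add_pos_nonneg)
qed

lemma tri_moment_measurable [measurable]: "tri_moment a \<in> borel_measurable borel"
  unfolding tri_moment_def cis_conv_exp by measurable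

section \<open>Schwartz functions and their Fourier transforms\<close>

text \<open>The quadratic decay makes the derivatives integrable, and with them the Fourier transform.\<close>

lemma schwartz_derivatives:
  assumes "f \<in> schwartz"
  obtains D where "D 0 = f" "\<And>n x. (D n has_vector_derivative D (Suc n) x) (at x)"
    "\<And>n. \<exists>B\<ge>0. \<forall>x. cmod (D n x) \<le> B * decay x"
proof -
  obtain D where D: "D 0 = f" "\<And>n x. (D n has_vector_derivative D (Suc n) x) (at x)"
    "\<And>k n. bounded (range (\<lambda>x. of_real (x ^ k) * D n x))"
    using assms unfolding schwartz_def by blast
  have "\<exists>B\<ge>0. \<forall>x. cmod (D n x) \<le> B * decay x" for n
  proof -
    obtain B0 where B0: "\<And>x. cmod (of_real (x ^ 0) * D n x) \<le> B0"
      using D(3)[of 0 n] unfolding bounded_iff by blast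
    obtain B2 where B2: "\<And>x. cmod (of_real (x ^ 2) * D n x) \<le> B2"
      using D(3)[of 2 n] unfolding bounded_iff by blast
    have "cmod (D n x) \<le> (B0 + B2) * decay x" for x
    proof -
      have "(1 + x\<^sup>2) * cmod (D n x) \<le> B0 + B2"
        using B0[of x] B2[of x] by (simp add: norm_mult norm_power distrib_right)
      then show ?thesis by (simp add: decay_def field_simps add_pos_nonneg)
    qed
    moreover have "B0 + B2 \<ge> 0"
      using order_trans[OF norm_ge_zero B0[of 0]] order_trans[OF norm_ge_zero B2[of 0]] by simp
    ultimately show ?thesis by blast
  qed
  with D that show thesis by blast
qed

lemma borel_measurable_derivative_chain:
  fixes g :: "real \<Rightarrow> complex"
  assumes "\<And>x. (g has_vector_derivative g' x) (at x)"
  shows "g \<in> borel_measurable borel"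
  using assms
  by (intro borel_measurable_continuous_onI continuous_at_imp_continuous_on ballI)
     (auto intro: has_vector_derivative_continuous)

lemma integrable_decay_bound:
  fixes g :: "real \<Rightarrow> complex"
  assumes "g \<in> borel_measurable borel" "\<And>x. cmod (g x) \<le> B * decay x"
  shows "integrable lborel g"
proof (rule Bochner_Integration.integrable_bound)
  show "integrable lborel (\<lambda>x. B * decay x)" using integrable_decay by simp
  show "AE x in lborel. cmod (g x) \<le> norm (B * decay x)"
    using assms(2) by (intro AE_I2) (simp add: order_trans[OF _ abs_ge_self])
qed (use assms in simp)

lemma schwartz_borel: "f \<in> schwartz \<Longrightarrow> f \<in> borel_measurable borel"
  by (elim schwartz_derivatives) (metis borel_measurable_derivative_chain)

lemma schwartz_bound:
  assumes "f \<in> schwartz"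
  obtains B where "B \<ge> 0" "\<And>x. cmod (f x) \<le> B * decay x"
  using assms by (elim schwartz_derivatives) metis

lemma schwartz_integrable: "f \<in> schwartz \<Longrightarrow> integrable lborel f"
  by (meson integrable_decay_bound schwartz_borel schwartz_bound)

lemma decay_tendsto_0: "(decay \<longlongrightarrow> 0) at_top" "(decay \<longlongrightarrow> 0) at_bot"
proof -
  have "decay = (\<lambda>x. inverse (1 + x ^ 2))" by (simp add: fun_eq_iff decay_def inverse_eq_divide)
  moreover have lim: "filterlim (\<lambda>x::real. 1 + x ^ 2) at_top at_top" "filterlim (\<lambda>x::real. 1 + x ^ 2) at_top at_bot"
    by (intro filterlim_tendsto_add_at_top[OF tendsto_const] filterlim_pow_at_top filterlim_pow_at_bot_even filterlim_ident; simp)+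
  ultimately show "(decay \<longlongrightarrow> 0) at_top" "(decay \<longlongrightarrow> 0) at_bot"
    using tendsto_inverse_0_at_top[OF lim(1)] tendsto_inverse_0_at_top[OF lim(2)] by simp_all
qed

lemma integral_derivative_eq_0:
  fixes u u' :: "real \<Rightarrow> complex"
  assumes d: "\<And>x. (u has_vector_derivative u' x) (at x)" and c: "\<And>x. isCont u' x"
    and b: "\<And>x. cmod (u x) \<le> B * decay x" and i: "integrable lborel u'"
  shows "(LINT x|lborel. u' x) = 0"
proof -
  have lim: "(u \<longlongrightarrow> 0) F" if "(decay \<longlongrightarrow> 0) F" for F
    by (rule Lim_null_comparison[where g = "\<lambda>x. B * decay x"])
       (use b that in \<open>auto intro!: tendsto_mult_right_zero\<close>)
  have "(LBINT x=-\<infinity>..\<infinity>. u' x) = 0 - 0"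
  proof (rule interval_integral_FTC_integrable)
    show "set_integrable lborel (einterval (-\<infinity>) \<infinity>) u'"
      using i by (simp add: set_integrable_def)
  qed (use d c lim decay_tendsto_0 in \<open>auto simp: ereal_tendsto_simps1\<close>)
  then show ?thesis
    by (simp add: interval_integral_to_infinity_eq interval_lebesgue_integral_def set_lebesgue_integral_def)
qed

lemma fourier_lborel:
  assumes "f \<in> borel_measurable borel"
  shows "fourier f \<xi> = (LINT x|lborel. f x * cis (- 2 * pi * x * \<xi>))"
  unfolding fourier_def using assms
  by (intro integral_completion) (simp add: cis_conv_exp)

lemma fourier_measurable:
  assumes [measurable]: "f \<in> borel_measurable borel"
  shows "fourier f \<in> borel_measurable borel"
proof -
  have "fourier f = (\<lambda>\<xi>. LINT x|lborel. f x * cis (- 2 * pi * x * \<xi>))"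
    by (intro ext fourier_lborel assms)
  also have "\<dots> \<in> borel_measurable borel" unfolding cis_conv_exp by measurable
  finally show ?thesis .
qed

lemma cis_borel_measurable [measurable (raw)]:
  "g \<in> borel_measurable M \<Longrightarrow> (\<lambda>x. cis (g x)) \<in> borel_measurable M"
  unfolding cis_conv_exp by measurable

lemma fourier_derivative:
  assumes d: "\<And>x. (u has_vector_derivative u' x) (at x)"
    and d': "\<And>x. (u' has_vector_derivative u'' x) (at x)"
    and b: "\<And>x. cmod (u x) \<le> B * decay x" "\<And>x. cmod (u' x) \<le> B' * decay x"
  shows "fourier u' \<xi> = 2 * pi * \<i> * of_real \<xi> * fourier u \<xi>"
proof -
  define e where "e = (\<lambda>x::real. cis ((- 2 * pi * \<xi>) * x))"
  have m[measurable]: "u \<in> borel_measurable borel" "u' \<in> borel_measurable borel"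
    using d d' by (blast intro: borel_measurable_derivative_chain)+
  have [measurable]: "e \<in> borel_measurable borel" unfolding e_def by measurable
  have i: "integrable lborel (\<lambda>x. u x * e x)" "integrable lborel (\<lambda>x. u' x * e x)"
    by (rule integrable_decay_bound[where B = B] integrable_decay_bound[where B = B'];
        use b in \<open>simp add: norm_mult e_def\<close>)+
  have fe: "fourier v \<xi> = (LINT x|lborel. v x * e x)" if "v \<in> borel_measurable borel" for v
    using that by (simp add: fourier_lborel e_def mult_ac)
  have "(LINT x|lborel. u x * (\<i> * of_real (- 2 * pi * \<xi>) * e x) + u' x * e x) = 0"
  proof (rule integral_derivative_eq_0)
    show "((\<lambda>x. u x * e x) has_vector_derivative u x * (\<i> * of_real (- 2 * pi * \<xi>) * e x) + u' x * e x) (at x)" for x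
      unfolding e_def by (intro has_vector_derivative_mult d has_vector_derivative_cis)
    show "cmod (u x * e x) \<le> B * decay x" for x using b by (simp add: norm_mult e_def)
    have "isCont u x" "isCont u' x" "isCont e x" for x
      using d d' has_vector_derivative_cis has_vector_derivative_continuous
      unfolding e_def by blast+
    then show "isCont (\<lambda>x. u x * (\<i> * of_real (- 2 * pi * \<xi>) * e x) + u' x * e x) x" for x
      by (intro continuous_intros)
    have "integrable lborel (\<lambda>x. (\<i> * of_real (- 2 * pi * \<xi>)) * (u x * e x) + u' x * e x)"
      using i by (intro Bochner_Integration.integrable_add integrable_mult_right)
    then show "integrable lborel (\<lambda>x. u x * (\<i> * of_real (- 2 * pi * \<xi>) * e x) + u' x * e x)"
      by (simp add: mult_ac)
  qed
  also have "(LINT x|lborel. u x * (\<i> * of_real (- 2 * pi * \<xi>) * e x) + u' x * e x)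
      = (LINT x|lborel. (\<i> * of_real (- 2 * pi * \<xi>)) * (u x * e x) + u' x * e x)"
    by (simp only: mult.left_commute mult.assoc)
  also have "\<dots> = (\<i> * of_real (- 2 * pi * \<xi>)) * fourier u \<xi> + fourier u' \<xi>"
    unfolding fe[OF m(1)] fe[OF m(2)] using i
    by (subst Bochner_Integration.integral_add) (auto intro!: integrable_mult_right simp: integral_mult_right_zero)
  finally show ?thesis by (simp add: add_eq_0_iff mult_ac)
qed

lemma norm_fourier_le:
  assumes "integrable lborel f"
  shows "cmod (fourier f \<xi>) \<le> (LINT x|lborel. cmod (f x))"
proof -
  have "f \<in> borel_measurable borel" using assms by auto
  then have "cmod (fourier f \<xi>) = cmod (LINT x|lborel. f x * cis (- 2 * pi * x * \<xi>))"
    by (simp only: fourier_lborel)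
  also have "\<dots> \<le> (LINT x|lborel. cmod (f x * cis (- 2 * pi * x * \<xi>)))" by (rule integral_norm_bound)
  finally show ?thesis by (simp add: norm_mult)
qed

text \<open>The second derivative of \<open>f\<close> has the transform \<open>- (2 * pi * \<xi>)\<^sup>2 * fourier f \<xi>\<close>, which is
  bounded.\<close>

lemma fourier_schwartz_decay:
  assumes "f \<in> schwartz"
  obtains B where "B \<ge> 0" "\<And>\<xi>. cmod (fourier f \<xi>) \<le> B * decay \<xi>"
proof -
  obtain D where D: "D 0 = f" "\<And>n x. (D n has_vector_derivative D (Suc n) x) (at x)"
    "\<And>n. \<exists>B\<ge>0. \<forall>x. cmod (D n x) \<le> B * decay x"
    using schwartz_derivatives[OF assms] by blast
  obtain B where B: "\<And>n x. cmod (D n x) \<le> B n * decay x" using D(3) by metis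
  have i: "integrable lborel (D n)" for n
    by (rule integrable_decay_bound[OF borel_measurable_derivative_chain[OF D(2)] B])
  have "fourier (D (Suc (Suc 0))) \<xi> = (2 * pi * \<i> * of_real \<xi>) * (2 * pi * \<i> * of_real \<xi>) * fourier (D 0) \<xi>" for \<xi>
    using fourier_derivative[OF D(2)[of "Suc 0"] D(2)[of "Suc (Suc 0)"] B B, of \<xi>] fourier_derivative[OF D(2)[of 0] D(2)[of "Suc 0"] B B, of \<xi>]
    by (simp add: mult.assoc)
  then have n2: "cmod (fourier (D (Suc (Suc 0))) \<xi>) = (2 * pi)\<^sup>2 * (\<xi>\<^sup>2 * cmod (fourier f \<xi>))" for \<xi>
    by (simp add: norm_mult D(1) power2_eq_square)
  define C where "C = (LINT x|lborel. cmod (D 0 x)) + (LINT x|lborel. cmod (D (Suc (Suc 0)) x))"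
  have "cmod (fourier f \<xi>) \<le> C * decay \<xi>" for \<xi>
  proof -
    have "1 * (\<xi>\<^sup>2 * cmod (fourier f \<xi>)) \<le> (2 * pi)\<^sup>2 * (\<xi>\<^sup>2 * cmod (fourier f \<xi>))"
      using pi_ge_two by (intro mult_right_mono one_le_power) auto
    then have "\<xi>\<^sup>2 * cmod (fourier f \<xi>) \<le> (LINT x|lborel. cmod (D (Suc (Suc 0)) x))"
      using norm_fourier_le[OF i[of "Suc (Suc 0)"], of \<xi>] n2[of \<xi>] by simp
    moreover have "cmod (fourier f \<xi>) \<le> (LINT x|lborel. cmod (D 0 x))"
      using norm_fourier_le[OF i[of 0]] D(1) by simp
    ultimately have "(1 + \<xi>\<^sup>2) * cmod (fourier f \<xi>) \<le> C" by (simp add: C_def distrib_right)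
    then show ?thesis by (simp add: decay_def field_simps add_pos_nonneg)
  qed
  moreover have "C \<ge> 0" unfolding C_def by (intro add_nonneg_nonneg Bochner_Integration.integral_nonneg) auto
  ultimately show thesis using that by blast
qed

lemma integrable_fourier_schwartz:
  assumes "f \<in> schwartz"
  shows "integrable lborel (fourier f)"
proof -
  obtain B where "\<And>\<xi>. cmod (fourier f \<xi>) \<le> B * decay \<xi>"
    using fourier_schwartz_decay[OF assms] by blast
  then show ?thesis
    by (rule integrable_decay_bound[OF fourier_measurable[OF schwartz_borel[OF assms]]])
qed

lemma Lp_norm_schwartz_finite:
  assumes f: "f \<in> schwartz" and p: "p \<ge> 1"
  shows "Lp_norm p lebesgue f < \<infinity>"
proof -
  obtain B where B: "B \<ge> 0" "\<And>x. cmod (f x) \<le> B * decay x" 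
    using schwartz_bound[OF f] by blast
  note [measurable] = schwartz_borel[OF f]
  show ?thesis
  proof (cases p)
    case (real r)
    then have r: "r \<ge> 1" using p by (simp flip: ennreal_1)
    have "(\<integral>\<^sup>+x. ennreal (cmod (f x) powr r) \<partial>lebesgue) = (\<integral>\<^sup>+x. ennreal (cmod (f x) powr r) \<partial>lborel)"
      by (rule nn_integral_completion)
    also have "\<dots> \<le> (\<integral>\<^sup>+x. ennreal (B powr r * decay x) \<partial>lborel)"
    proof (intro nn_integral_mono ennreal_leI)
      fix x
      have "cmod (f x) powr r \<le> (B * decay x) powr r" using B r by (intro powr_mono2) auto
      also have "\<dots> = B powr r * decay x powr r" using B decay_pos[of x] by (simp add: powr_mult)
      also have "decay x powr r \<le> decay x powr 1"
        using r decay_pos[of x] decay_le_1[of x] by (intro powr_mono') auto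
      finally show "cmod (f x) powr r \<le> B powr r * decay x"
        using decay_pos[of x] by (simp add: mult_left_mono)
    qed
    also have "\<dots> = ennreal (LINT x|lborel. B powr r * decay x)"
      using integrable_decay by (intro nn_integral_eq_integral) (auto intro!: AE_I2 mult_nonneg_nonneg less_imp_le[OF decay_pos])
    also have "\<dots> < \<infinity>" by simp
    finally show ?thesis using real r by (simp add: Lp_norm_def Let_def)
  next
    case top
    have "cmod (f x) \<le> B" for x
      using B(2)[of x] mult_left_mono[OF decay_le_1 B(1), of x] by simp
    then have "Lp_norm \<infinity> lebesgue f \<le> ennreal B"
      by (intro Lp_norm_infinity_leI measurable_completion) auto
    also have "\<dots> < \<infinity>" by simp
    finally show ?thesis using top by simp
  qed
qed

section \<open>Frequency pieces and Fejer polynomials\<close>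

text \<open>For \<open>a = 0\<close> this is the part of \<open>f\<close> with frequencies near \<open>n\<close>, cut out by a translate of the triangle
  and evaluated at \<open>x\<close>. The tent extension acts on \<open>f\<close> and \<open>g\<close> through these numbers only. The powers
  with exponent \<open>a\<close> appear as the Taylor coefficients in \<open>x\<close> after the carrier frequency \<open>n\<close> is removed.\<close>

definition frequency_piece :: "(real \<Rightarrow> complex) \<Rightarrow> nat \<Rightarrow> real \<Rightarrow> int \<Rightarrow> complex" where
  "frequency_piece f a x n = (LINT \<xi>|lborel. fourier f \<xi> * of_real (tri (\<xi> - of_int n) * (\<xi> - of_int n) ^ a)
     * cis (2 * pi * x * \<xi>))"

lemma frequency_piece_integrable:
  assumes "f \<in> schwartz"
  shows "integrable lborel (\<lambda>\<xi>. fourier f \<xi> * of_real (tri (\<xi> - of_int n) * (\<xi> - of_int n) ^ a)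
     * cis (2 * pi * x * \<xi>))"
proof (rule Bochner_Integration.integrable_bound[OF integrable_fourier_schwartz[OF assms]])
  note [measurable] = fourier_measurable[OF schwartz_borel[OF assms]]
  show "(\<lambda>\<xi>. fourier f \<xi> * of_real (tri (\<xi> - of_int n) * (\<xi> - of_int n) ^ a) * cis (2 * pi * x * \<xi>))
      \<in> borel_measurable lborel" by measurable
  show "AE \<xi> in lborel. cmod (fourier f \<xi> * of_real (tri (\<xi> - of_int n) * (\<xi> - of_int n) ^ a)
     * cis (2 * pi * x * \<xi>)) \<le> cmod (fourier f \<xi>)"
    unfolding norm_mult norm_cis norm_of_real
    using tri_power_le_1 by (intro AE_I2) (simp add: mult_left_le)
qed

lemma frequency_piece_measurable:
  assumes "f \<in> schwartz"
  shows "(\<lambda>x. frequency_piece f a x n) \<in> borel_measurable borel"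
proof -
  note [measurable] = fourier_measurable[OF schwartz_borel[OF assms]]
  show ?thesis unfolding frequency_piece_def by measurable
qed

text \<open>Write \<open>\<xi> = n + s\<close> with \<open>|s| \<le> 1\<close>. Then \<open>cis (2 * pi * t * \<xi>)\<close> is \<open>character n t\<close> times the exponential
  series of \<open>2 * pi * \<i> * t * s\<close>. This separates the dependence on \<open>t\<close> from the frequency, apart from the factor
  \<open>character n t\<close> that belongs on the torus.\<close>

lemma frequency_piece_taylor:
  assumes f: "f \<in> schwartz"
  shows "(\<lambda>a. (2 * pi * \<i> * of_real t) ^ a / fact a * frequency_piece f a (of_int k) n * character n t)
     sums frequency_piece f 0 (of_int k + t) n"
proof -
  define z where "z = 2 * pi * \<i> * complex_of_real t"
  define h where "h a \<xi> = z ^ a / fact a * (fourier f \<xi> * of_real (tri (\<xi> - of_int n) * (\<xi> - of_int n) ^ a)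
     * cis (2 * pi * of_int k * \<xi>)) * character n t" for a \<xi>
  have h_int: "integrable lborel (h a)" for a
    unfolding h_def by (intro integrable_mult_left integrable_mult_right frequency_piece_integrable f)
  have h_bound: "cmod (h a \<xi>) \<le> norm z ^ a / fact a * cmod (fourier f \<xi>)" for a \<xi>
  proof -
    have "cmod (h a \<xi>) = norm z ^ a / fact a * (cmod (fourier f \<xi>) * \<bar>tri (\<xi> - of_int n) * (\<xi> - of_int n) ^ a\<bar>)"
      unfolding h_def norm_mult norm_divide norm_cis norm_of_real norm_character norm_power norm_fact by simp
    also have "\<dots> \<le> norm z ^ a / fact a * (cmod (fourier f \<xi>) * 1)"
      by (intro mult_left_mono tri_power_le_1) auto
    finally show ?thesis by simp
  qed
  have exp_summable: "summable (\<lambda>a. norm z ^ a / fact a)"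
    using summable_exp[of "norm z"] by (simp add: divide_inverse mult.commute)
  have h_sums: "(\<lambda>a. h a \<xi>) sums (fourier f \<xi> * of_real (tri (\<xi> - of_int n) * (\<xi> - of_int n) ^ 0)
     * cis (2 * pi * (of_int k + t) * \<xi>))" for \<xi>
  proof -
    have "(\<lambda>a. (z * of_real (\<xi> - of_int n)) ^ a /\<^sub>R fact a) sums exp (z * of_real (\<xi> - of_int n))"
      by (rule exp_converges)
    then have "(\<lambda>a. (fourier f \<xi> * of_real (tri (\<xi> - of_int n)) * cis (2 * pi * of_int k * \<xi>) * character n t)
        * ((z * of_real (\<xi> - of_int n)) ^ a /\<^sub>R fact a)) sums
        ((fourier f \<xi> * of_real (tri (\<xi> - of_int n)) * cis (2 * pi * of_int k * \<xi>) * character n t)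
        * exp (z * of_real (\<xi> - of_int n)))"
      by (rule sums_mult)
    moreover have "(fourier f \<xi> * of_real (tri (\<xi> - of_int n)) * cis (2 * pi * of_int k * \<xi>) * character n t)
        * ((z * of_real (\<xi> - of_int n)) ^ a /\<^sub>R fact a) = h a \<xi>" for a
      by (simp add: h_def scaleR_conv_of_real power_mult_distrib divide_inverse mult_ac)
    moreover have "exp (z * of_real (\<xi> - of_int n)) = cis (2 * pi * t * (\<xi> - of_int n))"
      by (simp add: z_def cis_conv_exp mult_ac)
    moreover have "cis (2 * pi * of_int k * \<xi>) * character n t * cis (2 * pi * t * (\<xi> - of_int n))
        = cis (2 * pi * (of_int k + t) * \<xi>)"
      by (simp add: character_def cis_mult algebra_simps)
    ultimately show ?thesis by (simp add: mult.assoc)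
  qed
  have "(\<lambda>a. integral\<^sup>L lborel (h a)) sums (LINT \<xi>|lborel. (\<Sum>a. h a \<xi>))"
  proof (rule sums_integral)
    show "AE \<xi> in lborel. summable (\<lambda>a. cmod (h a \<xi>))"
    proof (rule AE_I2)
      fix \<xi>
      show "summable (\<lambda>a. cmod (h a \<xi>))"
        using h_bound by (intro summable_comparison_test'[OF summable_mult2[OF exp_summable]]) auto
    qed
    have "(LINT \<xi>|lborel. cmod (h a \<xi>)) \<le> norm z ^ a / fact a * (LINT \<xi>|lborel. cmod (fourier f \<xi>))" for a
    proof -
      have "(LINT \<xi>|lborel. cmod (h a \<xi>)) \<le> (LINT \<xi>|lborel. norm z ^ a / fact a * cmod (fourier f \<xi>))"
        using h_int integrable_fourier_schwartz[OF f] h_bound by (intro integral_mono) auto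
      then show ?thesis by simp
    qed
    then show "summable (\<lambda>a. LINT \<xi>|lborel. cmod (h a \<xi>))"
      by (intro summable_comparison_test'[OF summable_mult2[OF exp_summable]])
         (auto simp: Bochner_Integration.integral_nonneg)
  qed (rule h_int)
  moreover have "integral\<^sup>L lborel (h a) = z ^ a / fact a * frequency_piece f a (of_int k) n * character n t" for a
    unfolding h_def frequency_piece_def by simp
  moreover have "(LINT \<xi>|lborel. (\<Sum>a. h a \<xi>)) = frequency_piece f 0 (of_int k + t) n"
    unfolding frequency_piece_def by (simp only: sums_unique[OF h_sums, symmetric])
  ultimately show ?thesis by (simp add: z_def)
qed

text \<open>By Fubini's theorem the frequency pieces at an integer are Fourier coefficients of the product
  of \<open>f\<close> with a translated kernel, or in other words of its periodisation. That \<open>k\<close> is an integer matters: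
  \<open>character n k = 1\<close>, so the index \<open>n\<close> enters only through \<open>character (- n) u\<close>.\<close>

lemma frequency_piece_eq_moment_integral:
  assumes f: "f \<in> schwartz"
  shows "frequency_piece f a (of_int k) n = (LINT u|lborel. f u * tri_moment a (of_int k - u) * character (- n) u)"
proof -
  note [measurable] = schwartz_borel[OF f]
  define T where "T \<xi> = complex_of_real (tri (\<xi> - of_int n) * (\<xi> - of_int n) ^ a)" for \<xi>
  have [measurable]: "T \<in> borel_measurable borel" unfolding T_def by measurable
  define h where "h \<xi> u = f u * cis (- 2 * pi * u * \<xi>) * (T \<xi> * cis (2 * pi * of_int k * \<xi>))" for \<xi> u
  have T_int: "integrable lborel T"
  proof -
    have "integrable lborel (\<lambda>\<xi>. of_real (tri \<xi> * \<xi> ^ a) * cis (0 * \<xi>) :: complex)"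
      by (rule tri_integrable)
    then have "integrable lborel (\<lambda>\<xi>. of_real (tri (- of_int n + 1 * \<xi>) * (- of_int n + 1 * \<xi>) ^ a) * cis (0 * (- of_int n + 1 * \<xi>)) :: complex)"
      by (rule lborel_integrable_real_affine) simp
    then show ?thesis by (simp add: T_def[abs_def])
  qed
  \<comment> \<open>The absolute value is a product, so Fubini's theorem applies to \<open>h\<close>.\<close>
  have norm_h: "cmod (h \<xi> u) = cmod (f u) * cmod (T \<xi>)" for \<xi> u
    by (simp add: h_def norm_mult)
  have "integrable (lborel \<Otimes>\<^sub>M lborel) (\<lambda>(\<xi>, u). h \<xi> u)"
  proof (rule lborel_pair.Fubini_integrable)
    show "(\<lambda>(\<xi>, u). h \<xi> u) \<in> borel_measurable (lborel \<Otimes>\<^sub>M lborel)" unfolding h_def by measurable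
    show "integrable lborel (\<lambda>\<xi>. LINT u|lborel. norm (case (\<xi>, u) of (\<xi>, u) \<Rightarrow> h \<xi> u))"
      unfolding prod.case norm_h using T_int by simp
    show "AE \<xi> in lborel. integrable lborel (\<lambda>u. case (\<xi>, u) of (\<xi>, u) \<Rightarrow> h \<xi> u)"
    proof (rule AE_I2)
      fix \<xi>
      have [measurable]: "h \<xi> \<in> borel_measurable borel" unfolding h_def by measurable
      have "integrable lborel (\<lambda>u. f u * T \<xi>)" using schwartz_integrable[OF f] by simp
      then have "integrable lborel (h \<xi>)"
        by (rule Bochner_Integration.integrable_bound) (auto simp: norm_h norm_mult)
      then show "integrable lborel (\<lambda>u. case (\<xi>, u) of (\<xi>, u) \<Rightarrow> h \<xi> u)" by simp
    qed
  qed
  then have "(LINT u|lborel. LINT \<xi>|lborel. h \<xi> u) = (LINT \<xi>|lborel. LINT u|lborel. h \<xi> u)"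
    by (rule lborel_pair.Fubini_integral)
  moreover have "(LINT \<xi>|lborel. LINT u|lborel. h \<xi> u) = frequency_piece f a (of_int k) n"
    unfolding frequency_piece_def h_def T_def integral_mult_left_zero fourier_lborel[OF schwartz_borel[OF f]]
    by (simp only: mult.assoc)
  moreover have "(LINT \<xi>|lborel. h \<xi> u) = f u * tri_moment a (of_int k - u) * character (- n) u" for u
  proof -
    have "(LINT \<xi>|lborel. h \<xi> u) = (LINT \<xi>|lborel. h (of_int n + 1 * \<xi>) u)"
      by (subst lborel_integral_real_affine[where c = 1 and t = "of_int n"]) auto
    also have "\<dots> = (LINT s|lborel. f u * (character (- n) u * (of_real (tri s * s ^ a) * cis (2 * pi * (of_int k - u) * s))))"
    proof (rule Bochner_Integration.integral_cong[OF refl])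
      fix s
      have "cis (- 2 * pi * u * (of_int n + s)) * cis (2 * pi * of_int k * (of_int n + s))
          = character n (of_int k) * character (- n) u * cis (2 * pi * (of_int k - u) * s)"
        unfolding character_def cis_mult by (rule arg_cong[where f = cis]) (simp add: algebra_simps)
      then have "cis (- 2 * pi * u * (of_int n + s)) * cis (2 * pi * of_int k * (of_int n + s))
          = character (- n) u * cis (2 * pi * (of_int k - u) * s)"
        by simp
      then show "h (of_int n + 1 * s) u
          = f u * (character (- n) u * (of_real (tri s * s ^ a) * cis (2 * pi * (of_int k - u) * s)))"
        by (simp add: h_def T_def mult_ac)
    qed
    also have "\<dots> = f u * (character (- n) u * tri_moment a (of_int k - u))"
      unfolding tri_moment_def by simp
    finally show ?thesis by (simp add: mult_ac)
  qed
  ultimately show ?thesis by simp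
qed

text \<open>The Fejer mean of the periodisation of \<open>\<lambda>u. f u * tri_moment a (k - u)\<close>, given by its Fourier
  coefficients. The multiplier on the torus is applied to these trigonometric polynomials.\<close>

definition fejer_poly :: "(real \<Rightarrow> complex) \<Rightarrow> nat \<Rightarrow> int \<Rightarrow> nat \<Rightarrow> real \<Rightarrow> complex" where
  "fejer_poly f N k a y =
     (\<Sum>n\<in>{-int N..int N}. (of_real (fejer_weight N n) * frequency_piece f a (of_int k) n) * character n y)"

lemma fejer_poly_eq_integral:
  assumes f: "f \<in> schwartz" and N: "N > 0"
  shows "fejer_poly f N k a y
    = (LINT u|lborel. f u * tri_moment a (of_int k - u) * of_real (fejer_kernel N (y - u)))"
proof -
  note [measurable] = schwartz_borel[OF f]
  have i: "integrable lborel (\<lambda>u. f u * tri_moment a (of_int k - u) * character (- n) u)" for n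
  proof (rule Bochner_Integration.integrable_bound)
    show "integrable lborel (\<lambda>u. f u * 2)" using schwartz_integrable[OF f] by simp
    show "AE u in lborel. cmod (f u * tri_moment a (of_int k - u) * character (- n) u) \<le> cmod (f u * 2)"
      unfolding norm_mult norm_character
      using tri_moment_bound_1 by (intro AE_I2) (auto intro!: mult_left_mono)
  qed measurable
  have "fejer_poly f N k a y = (\<Sum>n\<in>{-int N..int N}. LINT u|lborel. (of_real (fejer_weight N n) * character n y)
      * (f u * tri_moment a (of_int k - u) * character (- n) u))"
    unfolding fejer_poly_def frequency_piece_eq_moment_integral[OF f] integral_mult_right_zero
    by (simp only: mult_ac)
  also have "\<dots> = (LINT u|lborel. (\<Sum>n\<in>{-int N..int N}. (of_real (fejer_weight N n) * character n y)
      * (f u * tri_moment a (of_int k - u) * character (- n) u)))"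
    using i by (intro Bochner_Integration.integral_sum[symmetric] integrable_mult_right)
  also have "\<dots> = (LINT u|lborel. f u * tri_moment a (of_int k - u) * of_real (fejer_kernel N (y - u)))"
  proof (rule Bochner_Integration.integral_cong[OF refl])
    fix u
    have "character n (y - u) = character n y * character (- n) u" for n
      using character_add_arg[of n y "- u"] by (simp add: character_minus_arg)
    then show "(\<Sum>n\<in>{-int N..int N}. (of_real (fejer_weight N n) * character n y)
      * (f u * tri_moment a (of_int k - u) * character (- n) u))
      = f u * tri_moment a (of_int k - u) * of_real (fejer_kernel N (y - u))"
      by (simp add: fejer_kernel_expansion[OF N] sum_distrib_left mult_ac)
  qed
  finally show ?thesis .
qed

lemma fejer_poly_borel [measurable]: "fejer_poly f N k a \<in> borel_measurable borel"
  unfolding fejer_poly_def by measurable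

text \<open>Cut the line into translates of the torus. The Fejer kernel is periodic, the lattice sum of
  the decaying factor is bounded, and the Fejer kernel has mass 1 on the torus.\<close>

lemma fejer_decay_mass:
  assumes N: "N > 0"
  shows "(\<integral>\<^sup>+u. ennreal (decay (of_int k - u) * fejer_kernel N (y - u)) \<partial>lborel) \<le> ennreal decay_mass"
proof -
  have fe: "fejer_kernel N (y - (of_int r + t)) = fejer_kernel N (t - y)" for r t
    using fejer_kernel_periodic[of N "t - y" r] fejer_kernel_minus[of N "t - y + of_int r"]
    by (simp add: algebra_simps)
  have de: "decay (of_int k - (of_int r + t)) = decay (of_int r - (of_int k - t))" for r :: int and t
    using decay_minus[of "of_int k - (of_int r + t)"] by (simp add: algebra_simps)
  have "(\<integral>\<^sup>+u. ennreal (decay (of_int k - u) * fejer_kernel N (y - u)) \<partial>lborel)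
    = (\<integral>\<^sup>+r. \<integral>\<^sup>+t. ennreal (decay (of_int k - (of_int r + t)) * fejer_kernel N (y - (of_int r + t))) \<partial>torus \<partial>count_space (UNIV :: int set))"
    by (rule nn_integral_blocks) measurable
  also have "\<dots> = (\<integral>\<^sup>+r. \<integral>\<^sup>+t. ennreal (fejer_kernel N (t - y)) * ennreal (decay (of_int r - (of_int k - t))) \<partial>torus \<partial>count_space (UNIV :: int set))"
    unfolding fe de by (intro nn_integral_cong) (simp add: ennreal_mult fejer_kernel_nonneg less_imp_le[OF decay_pos] mult.commute)
  also have "\<dots> = (\<integral>\<^sup>+t. \<integral>\<^sup>+r. ennreal (fejer_kernel N (t - y)) * ennreal (decay (of_int r - (of_int k - t))) \<partial>count_space (UNIV :: int set) \<partial>torus)"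
  proof (rule nn_integral_count_space_nn_integral[symmetric])
    show "(\<lambda>t. ennreal (fejer_kernel N (t - y)) * ennreal (decay (of_int r - (of_int k - t))))
        \<in> borel_measurable torus" for r
      by (rule borel_measurable_torus) measurable
  qed simp
  also have "\<dots> = (\<integral>\<^sup>+t. ennreal (fejer_kernel N (t - y)) * (\<integral>\<^sup>+r. ennreal (decay (of_int r - (of_int k - t))) \<partial>count_space (UNIV :: int set)) \<partial>torus)"
    by (intro nn_integral_cong nn_integral_cmult) simp
  also have "\<dots> \<le> (\<integral>\<^sup>+t. ennreal (fejer_kernel N (t - y)) * ennreal decay_mass \<partial>torus)"
    by (intro nn_integral_mono mult_left_mono sum_decay_le) simp
  also have "\<dots> = (\<integral>\<^sup>+t. ennreal (fejer_kernel N (t - y)) \<partial>torus) * ennreal decay_mass"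
    by (rule nn_integral_multc, rule borel_measurable_torus) measurable
  also have "\<dots> = ennreal decay_mass" by (simp only: integral_fejer_kernel[OF N] mult_1_left)
  finally show ?thesis .
qed

section \<open>Norm bounds for the Fejer polynomials\<close>

lemma nn_integral_torus_lborel_swap:
  assumes [measurable]: "(\<lambda>(y, u). h y u) \<in> borel_measurable (borel \<Otimes>\<^sub>M borel)"
  shows "(\<integral>\<^sup>+y. \<integral>\<^sup>+u. h y u \<partial>lborel \<partial>torus) = (\<integral>\<^sup>+u. \<integral>\<^sup>+y. h y u \<partial>torus \<partial>lborel)"
proof -
  have "(\<integral>\<^sup>+y. \<integral>\<^sup>+u. h y u \<partial>lborel \<partial>torus)
      = (\<integral>\<^sup>+y. \<integral>\<^sup>+u. h y u * indicator {- 1 / 2 ..< 1 / 2} y \<partial>lborel \<partial>lborel)"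
    by (subst nn_integral_torus) (simp_all add: nn_integral_multc)
  also have "\<dots> = (\<integral>\<^sup>+u. \<integral>\<^sup>+y. h y u * indicator {- 1 / 2 ..< 1 / 2} y \<partial>lborel \<partial>lborel)"
    by (rule lborel_pair.Fubini') measurable
  also have "\<dots> = (\<integral>\<^sup>+u. \<integral>\<^sup>+y. h y u \<partial>torus \<partial>lborel)"
    by (intro nn_integral_cong nn_integral_torus[symmetric]) measurable
  finally show ?thesis .
qed

lemma fejer_decay_integrable: "integrable lborel (\<lambda>u. decay (of_int k - u) * fejer_kernel N (y - u))"
proof (rule Bochner_Integration.integrable_bound)
  have "integrable lborel (\<lambda>u. decay (of_int k + (- 1) * u))"
    by (rule lborel_integrable_real_affine[OF integrable_decay]) simp
  then show "integrable lborel (\<lambda>u. decay (of_int k - u) * real N)" by simp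
  show "AE u in lborel. norm (decay (of_int k - u) * fejer_kernel N (y - u)) \<le> norm (decay (of_int k - u) * real N)"
    using fejer_kernel_nonneg fejer_kernel_bounded
    by (intro AE_I2) (simp add: abs_mult mult_left_mono)
qed measurable

lemma integral_fejer_decay_le:
  assumes "N > 0"
  shows "(LINT u|lborel. decay (of_int k - u) * fejer_kernel N (y - u)) \<le> decay_mass"
proof -
  have "ennreal (LINT u|lborel. decay (of_int k - u) * fejer_kernel N (y - u))
    = (\<integral>\<^sup>+u. ennreal (decay (of_int k - u) * fejer_kernel N (y - u)) \<partial>lborel)"
    using fejer_decay_integrable
    by (intro nn_integral_eq_integral[symmetric]) (auto simp: fejer_kernel_nonneg)
  also have "\<dots> \<le> ennreal decay_mass" by (rule fejer_decay_mass[OF assms])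
  finally show ?thesis using decay_mass_pos by (simp add: ennreal_le_iff)
qed

lemma fejer_decay_integrable_powr:
  assumes f: "f \<in> schwartz" and r: "r > 0"
  shows "integrable lborel (\<lambda>u. cmod (f u) powr r * (decay (of_int k - u) * fejer_kernel N (y - u)))"
proof -
  note [measurable] = schwartz_borel[OF f]
  obtain B where B: "B \<ge> 0" "\<And>x. cmod (f x) \<le> B * decay x" using schwartz_bound[OF f] by blast
  have fB: "cmod (f x) powr r \<le> B powr r" for x
    using B(2)[of x] mult_left_mono[OF decay_le_1 B(1), of x] r by (intro powr_mono2) auto
  show ?thesis
  proof (rule Bochner_Integration.integrable_bound)
    show "integrable lborel (\<lambda>u. B powr r * (decay (of_int k - u) * fejer_kernel N (y - u)))"
      using fejer_decay_integrable by (rule integrable_mult_right)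
    show "AE u in lborel. norm (cmod (f u) powr r * (decay (of_int k - u) * fejer_kernel N (y - u)))
        \<le> norm (B powr r * (decay (of_int k - u) * fejer_kernel N (y - u)))"
      using fB by (intro AE_I2) (simp add: abs_mult fejer_kernel_nonneg mult_right_mono)
  qed measurable
qed

lemma fejer_poly_pointwise:
  assumes f: "f \<in> schwartz" and N: "N > 0"
  shows "cmod (fejer_poly f N k a y)
    \<le> 10 * 4 ^ a * (LINT u|lborel. cmod (f u) * (decay (of_int k - u) * fejer_kernel N (y - u)))"
proof -
  note [measurable] = schwartz_borel[OF f]
  let ?w = "\<lambda>u. decay (of_int k - u) * fejer_kernel N (y - u)"
  let ?h = "\<lambda>u. f u * tri_moment a (of_int k - u) * of_real (fejer_kernel N (y - u))"
  have le: "cmod (?h u) \<le> 10 * 4 ^ a * (cmod (f u) * ?w u)" for u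
  proof -
    have "cmod (?h u) = cmod (f u) * cmod (tri_moment a (of_int k - u)) * fejer_kernel N (y - u)"
      by (simp add: norm_mult fejer_kernel_nonneg)
    also have "\<dots> \<le> cmod (f u) * (10 * 4 ^ a * decay (of_int k - u)) * fejer_kernel N (y - u)"
      by (intro mult_right_mono mult_left_mono tri_moment_decay fejer_kernel_nonneg) auto
    finally show ?thesis by (simp add: mult_ac)
  qed
  have "cmod (fejer_poly f N k a y) \<le> (LINT u|lborel. cmod (?h u))"
    unfolding fejer_poly_eq_integral[OF f N] by (rule integral_norm_bound)
  also have "\<dots> \<le> (LINT u|lborel. 10 * 4 ^ a * (cmod (f u) * ?w u))"
  proof (rule integral_mono)
    show i: "integrable lborel (\<lambda>u. 10 * 4 ^ a * (cmod (f u) * ?w u))"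
      using fejer_decay_integrable_powr[OF f, of 1 k N y] by (intro integrable_mult_right) simp
    show "integrable lborel (\<lambda>u. cmod (?h u))"
      by (rule Bochner_Integration.integrable_bound[OF i])
         (measurable, use le in \<open>auto intro!: AE_I2 intro: order_trans[OF _ abs_ge_self]\<close>)
  qed (rule le)
  finally show ?thesis by simp
qed

text \<open>Summed over all blocks \<open>k\<close>, the Fejer polynomials are controlled by \<open>f\<close>. By Jensen's
  inequality, the \<open>r\<close>-th power of a Fejer polynomial at \<open>y\<close> is at most a multiple of the integral of \<open>|f u| powr r\<close> against the weight
  \<open>decay (k - u) * fejer_kernel N (y - u)\<close>. Integrating this over \<open>y\<close> removes the Fejer kernel, summing over \<open>k\<close>
  removes the decaying factor, and the norm of \<open>f\<close> remains. The bound does not depend on \<open>N\<close>.\<close>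

lemma fejer_poly_Lp_norm:
  assumes f: "f \<in> schwartz" and N: "N > 0" and p: "p \<ge> 1"
  obtains x :: "int \<Rightarrow> real" where "\<And>k. x k \<ge> 0"
    "\<And>k. Lp_norm p torus (fejer_poly f N k a) \<le> ennreal (x k)"
    "Lp_norm p (count_space UNIV) (\<lambda>k. complex_of_real (x k))
      \<le> ennreal (10 * 4 ^ a * decay_mass * enn2real (Lp_norm p lebesgue f))"
proof -
  note [measurable] = schwartz_borel[OF f]
  define nf where "nf = enn2real (Lp_norm p lebesgue f)"
  have nf: "Lp_norm p lebesgue f = ennreal nf" "nf \<ge> 0"
    using Lp_norm_schwartz_finite[OF f p] by (auto simp: nf_def)
  define K where "K = (10 * 4 ^ a :: real)"
  have K: "K > 0" by (simp add: K_def)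
  have i1: "integrable lborel (\<lambda>u. cmod (f u) * (decay (of_int k - u) * fejer_kernel N (y - u)))" for k y
    using fejer_decay_integrable_powr[OF f, of 1 k N y] by simp
  show thesis
  proof (cases p)
    case top
    have "AE u in lebesgue. cmod (f u) \<le> nf"
      using nf top by (intro Lp_norm_infinity_AE) auto
    then have ae: "AE u in lborel. cmod (f u) \<le> nf" by (simp add: AE_completion_iff)
    have le: "cmod (fejer_poly f N k a y) \<le> K * decay_mass * nf" for k y
    proof -
      have "(LINT u|lborel. cmod (f u) * (decay (of_int k - u) * fejer_kernel N (y - u)))
          \<le> (LINT u|lborel. nf * (decay (of_int k - u) * fejer_kernel N (y - u)))"
        using ae by (intro integral_mono_AE i1 integrable_mult_right fejer_decay_integrable)
          (auto elim!: eventually_mono intro!: mult_right_mono simp: fejer_kernel_nonneg)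
      also have "\<dots> \<le> nf * decay_mass"
        using nf(2) integral_fejer_decay_le[OF N] by (simp add: mult_left_mono)
      finally show ?thesis
        using fejer_poly_pointwise[OF f N, of k a y] K unfolding K_def[symmetric]
        by (smt (verit, best) mult.assoc mult.commute mult_left_mono)
    qed
    have pos: "K * decay_mass * nf \<ge> 0" using K decay_mass_pos nf by simp
    show thesis
    proof (rule that[of "\<lambda>k. K * decay_mass * nf"])
      show "Lp_norm p torus (fejer_poly f N k a) \<le> ennreal (K * decay_mass * nf)" for k
        unfolding top using Lp_norm_infinity_leI[OF borel_measurable_torus[OF fejer_poly_borel] AE_I2[OF le]]
        by simp
      have "Lp_norm \<infinity> (count_space UNIV) (\<lambda>k::int. complex_of_real (K * decay_mass * nf)) \<le> ennreal (K * decay_mass * nf)"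
        using pos K decay_mass_pos by (intro Lp_norm_infinity_leI) (auto intro!: AE_I2 simp: norm_mult nf)
      then show "Lp_norm p (count_space UNIV) (\<lambda>k::int. complex_of_real (K * decay_mass * nf))
      \<le> ennreal (10 * 4 ^ a * decay_mass * enn2real (Lp_norm p lebesgue f))"
        using top by (simp add: K_def nf_def)
    qed (use pos in simp)
  next
    case (real r)
    then have r: "r \<ge> 1" using p by (simp flip: ennreal_1)
    define c where "c = K powr r * decay_mass powr (r - 1)"
    have c: "c \<ge> 0" by (simp add: c_def)
    define J where "J k = (\<integral>\<^sup>+y. ennreal (cmod (fejer_poly f N k a y) powr r) \<partial>torus)" for k
    have J: "J k \<le> ennreal c * (\<integral>\<^sup>+u. ennreal (cmod (f u) powr r) * ennreal (decay (of_int k - u)) \<partial>lborel)" for k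
    proof -
      have ptw: "ennreal (cmod (fejer_poly f N k a y) powr r) \<le> ennreal c *
        (\<integral>\<^sup>+u. ennreal (cmod (f u) powr r) * ennreal (decay (of_int k - u)) * ennreal (fejer_kernel N (y - u)) \<partial>lborel)" for y
      proof -
        define w where "w u = decay (of_int k - u) * fejer_kernel N (y - u)" for u
        have w0: "w u \<ge> 0" for u by (simp add: w_def fejer_kernel_nonneg)
        have i: "integrable lborel (\<lambda>u. cmod (f u) powr r * w u)"
          unfolding w_def using r by (intro fejer_decay_integrable_powr[OF f]) simp
        have "cmod (fejer_poly f N k a y) powr r \<le> (K * (LINT u|lborel. cmod (f u) * w u)) powr r"
          using fejer_poly_pointwise[OF f N] r unfolding K_def w_def by (intro powr_mono2) auto
        also have "\<dots> = K powr r * (LINT u|lborel. cmod (f u) * w u) powr r"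
          using K w0 by (intro powr_mult) 
        also have "\<dots> \<le> K powr r * (decay_mass powr (r - 1) * (LINT u|lborel. cmod (f u) powr r * w u))"
          by (intro mult_left_mono weighted_power_mean)
             (use w0 r decay_mass_pos i integral_fejer_decay_le[OF N] fejer_decay_integrable i1
               in \<open>auto simp: w_def\<close>)
        also have "\<dots> = c * (LINT u|lborel. cmod (f u) powr r * w u)" by (simp add: c_def)
        finally have "ennreal (cmod (fejer_poly f N k a y) powr r) \<le> ennreal c * ennreal (LINT u|lborel. cmod (f u) powr r * w u)"
          using c w0 by (subst ennreal_mult[symmetric]) (auto intro!: ennreal_leI Bochner_Integration.integral_nonneg)
        also have "ennreal (LINT u|lborel. cmod (f u) powr r * w u) = (\<integral>\<^sup>+u. ennreal (cmod (f u) powr r * w u) \<partial>lborel)"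
          using i w0 by (intro nn_integral_eq_integral[symmetric]) auto
        also have "\<dots> = (\<integral>\<^sup>+u. ennreal (cmod (f u) powr r) * ennreal (decay (of_int k - u)) * ennreal (fejer_kernel N (y - u)) \<partial>lborel)"
          by (intro nn_integral_cong) (simp add: w_def fejer_kernel_nonneg ennreal_mult mult.assoc)
        finally show ?thesis .
      qed
      have "J k \<le> (\<integral>\<^sup>+y. ennreal c *
        (\<integral>\<^sup>+u. ennreal (cmod (f u) powr r) * ennreal (decay (of_int k - u)) * ennreal (fejer_kernel N (y - u)) \<partial>lborel) \<partial>torus)"
        unfolding J_def by (intro nn_integral_mono ptw)
      also have "\<dots> = ennreal c * (\<integral>\<^sup>+y.
        (\<integral>\<^sup>+u. ennreal (cmod (f u) powr r) * ennreal (decay (of_int k - u)) * ennreal (fejer_kernel N (y - u)) \<partial>lborel) \<partial>torus)"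
        by (rule nn_integral_cmult, rule borel_measurable_torus) measurable
      also have "(\<integral>\<^sup>+y.
        (\<integral>\<^sup>+u. ennreal (cmod (f u) powr r) * ennreal (decay (of_int k - u)) * ennreal (fejer_kernel N (y - u)) \<partial>lborel) \<partial>torus)
        = (\<integral>\<^sup>+u. \<integral>\<^sup>+y. ennreal (cmod (f u) powr r) * ennreal (decay (of_int k - u)) * ennreal (fejer_kernel N (y - u)) \<partial>torus \<partial>lborel)"
        by (rule nn_integral_torus_lborel_swap) measurable
      also have "\<dots> = (\<integral>\<^sup>+u. ennreal (cmod (f u) powr r) * ennreal (decay (of_int k - u)) \<partial>lborel)"
      proof (rule nn_integral_cong)
        fix u
        have "(\<integral>\<^sup>+y. ennreal (cmod (f u) powr r) * ennreal (decay (of_int k - u)) * ennreal (fejer_kernel N (y - u)) \<partial>torus)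
          = ennreal (cmod (f u) powr r) * ennreal (decay (of_int k - u)) * (\<integral>\<^sup>+y. ennreal (fejer_kernel N (y - u)) \<partial>torus)"
          by (rule nn_integral_cmult, rule borel_measurable_torus) measurable
        then show "(\<integral>\<^sup>+y. ennreal (cmod (f u) powr r) * ennreal (decay (of_int k - u)) * ennreal (fejer_kernel N (y - u)) \<partial>torus)
          = ennreal (cmod (f u) powr r) * ennreal (decay (of_int k - u))"
          by (simp only: integral_fejer_kernel[OF N] mult_1_right)
      qed
      finally show ?thesis .
    qed
    have "(\<integral>\<^sup>+k. J k \<partial>count_space UNIV)
        \<le> (\<integral>\<^sup>+k. ennreal c * (\<integral>\<^sup>+u. ennreal (cmod (f u) powr r) * ennreal (decay (of_int k - u)) \<partial>lborel) \<partial>count_space UNIV)"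
      by (intro nn_integral_mono J)
    also have "\<dots> = ennreal c * (\<integral>\<^sup>+k. (\<integral>\<^sup>+u. ennreal (cmod (f u) powr r) * ennreal (decay (of_int k - u)) \<partial>lborel) \<partial>count_space UNIV)"
      by (rule nn_integral_cmult) simp
    also have "(\<integral>\<^sup>+k. (\<integral>\<^sup>+u. ennreal (cmod (f u) powr r) * ennreal (decay (of_int k - u)) \<partial>lborel) \<partial>count_space (UNIV :: int set))
      = (\<integral>\<^sup>+u. (\<integral>\<^sup>+k. ennreal (cmod (f u) powr r) * ennreal (decay (of_int k - u)) \<partial>count_space (UNIV :: int set)) \<partial>lborel)"
      by (rule nn_integral_count_space_nn_integral[symmetric]) (simp, measurable)
    also have "\<dots> = (\<integral>\<^sup>+u. ennreal (cmod (f u) powr r) * (\<integral>\<^sup>+k. ennreal (decay (of_int k - u)) \<partial>count_space (UNIV :: int set)) \<partial>lborel)"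
      by (intro nn_integral_cong nn_integral_cmult) simp
    also have "\<dots> \<le> (\<integral>\<^sup>+u. ennreal (cmod (f u) powr r) * ennreal decay_mass \<partial>lborel)"
      by (intro nn_integral_mono mult_left_mono sum_decay_le) simp
    also have "\<dots> = (\<integral>\<^sup>+u. ennreal (cmod (f u) powr r) \<partial>lborel) * ennreal decay_mass"
      by (rule nn_integral_multc) measurable
    also have "(\<integral>\<^sup>+u. ennreal (cmod (f u) powr r) \<partial>lborel) = (\<integral>\<^sup>+u. ennreal (cmod (f u) powr r) \<partial>lebesgue)"
      by (rule nn_integral_completion[symmetric])
    also have "ennreal c * ((\<integral>\<^sup>+u. ennreal (cmod (f u) powr r) \<partial>lebesgue) * ennreal decay_mass)
        \<le> ennreal c * (ennreal (nf powr r) * ennreal decay_mass)"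
      using nf r real Lp_norm_le_iff[of r nf lebesgue f] by (intro mult_left_mono mult_right_mono) auto
    also have "\<dots> = ennreal ((K * decay_mass * nf) powr r)"
    proof -
      have "c * (nf powr r * decay_mass) = (K * decay_mass * nf) powr r"
        using K decay_mass_pos nf r by (simp add: c_def powr_mult powr_diff)
      then show ?thesis using c decay_mass_pos by (simp flip: ennreal_mult)
    qed
    finally have sumJ: "(\<integral>\<^sup>+k. J k \<partial>count_space UNIV) \<le> ennreal ((K * decay_mass * nf) powr r)"
      by (simp add: mult_left_mono)
    \<comment> \<open>The single integrals have to be finite before real block norms \<open>x k\<close> can be chosen.\<close>
    have J_le: "J k \<le> (\<integral>\<^sup>+k. J k \<partial>count_space UNIV)" for k
    proof -
      have "J k = (\<integral>\<^sup>+i. J i * indicator {k} i \<partial>count_space UNIV)"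
        by (subst nn_integral_indicator_singleton) auto
      also have "\<dots> \<le> (\<integral>\<^sup>+k. J k \<partial>count_space UNIV)"
        by (intro nn_integral_mono) (simp add: indicator_def)
      finally show ?thesis .
    qed
    have Jfin: "J k \<noteq> \<infinity>" for k
      using order_trans[OF J_le sumJ] by (metis ennreal_neq_top infinity_ennreal_def top_unique)
    define x where "x k = enn2real (J k) powr (1 / r)" for k
    have xr: "ennreal (x k powr r) = J k" for k
    proof -
      have "x k powr r = enn2real (J k)" using r by (simp add: x_def powr_powr)
      then show ?thesis using Jfin[of k] by (simp add: less_top)
    qed
    show thesis
    proof (rule that[of x])
      show x0: "x k \<ge> 0" for k by (simp add: x_def)
      show "Lp_norm p torus (fejer_poly f N k a) \<le> ennreal (x k)" for k
        unfolding real using r x0[of k] by (simp only: Lp_norm_le_iff xr J_def)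
      have "Lp_norm (ennreal r) (count_space UNIV) (\<lambda>k. complex_of_real (x k)) \<le> ennreal (K * decay_mass * nf)"
        using r K decay_mass_pos nf x0 sumJ by (subst Lp_norm_le_iff) (auto simp: xr)
      then show "Lp_norm p (count_space UNIV) (\<lambda>k. complex_of_real (x k))
        \<le> ennreal (10 * 4 ^ a * decay_mass * enn2real (Lp_norm p lebesgue f))"
        using real by (simp add: K_def nf_def)
    qed
  qed
qed

section \<open>Truncations of the tent extension\<close>

lemma Lp_norm_torus_const:
  assumes p: "p = \<infinity> \<or> (\<exists>r>0. p = ennreal r)"
    and f: "f \<in> borel_measurable borel" "\<And>x. cmod (f x) = c"
  shows "Lp_norm p torus f = ennreal c"
  using p
proof
  assume "p = \<infinity>"
  have "emeasure torus (space torus) \<noteq> 0" unfolding torus.emeasure_space_1 by simp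
  then show ?thesis 
    using \<open>p = \<infinity>\<close> unfolding Lp_norm_def f by (simp only: simp_thms if_True esssup_const)
next
  assume "\<exists>r>0. p = ennreal r"
  then obtain r where r: "r > 0" "p = ennreal r" by blast
  have "c \<ge> 0" using f(2)[of 0] norm_ge_zero by metis
  moreover have "(\<integral>\<^sup>+x. ennreal (c powr r) \<partial>torus) = ennreal (c powr r)"
    by (simp only: nn_integral_const torus.emeasure_space_1 mult_1_right)
  ultimately show ?thesis using r by (simp only: Lp_norm_def f) (simp add: Let_def powr_powr)
qed

lemma Lp_norm_dominated:
  assumes p: "p = \<infinity> \<or> (\<exists>r>0. p = ennreal r)"
    and [measurable]: "v \<in> borel_measurable M" "w \<in> borel_measurable M"
    and vw: "\<And>x. x \<in> space M \<Longrightarrow> cmod (v x) \<le> c * cmod (w x)" and cd: "c \<ge> 0" "d \<ge> 0"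
    and w: "Lp_norm p M w \<le> ennreal d"
  shows "Lp_norm p M v \<le> ennreal (c * d)"
  using p
proof
  assume p: "p = \<infinity>"
  have "AE x in M. cmod (w x) \<le> d" using w cd by (intro Lp_norm_infinity_AE) (auto simp: p)
  then have "AE x in M. cmod (v x) \<le> c * d"
    using AE_space by eventually_elim (meson vw cd mult_left_mono order_trans)
  then show ?thesis unfolding p by (intro Lp_norm_infinity_leI) auto
next
  assume "\<exists>r>0. p = ennreal r"
  then obtain r where r: "r > 0" "p = ennreal r" by blast
  have "(\<integral>\<^sup>+x. ennreal (cmod (v x) powr r) \<partial>M) \<le> (\<integral>\<^sup>+x. ennreal (c powr r) * ennreal (cmod (w x) powr r) \<partial>M)"
  proof (rule nn_integral_mono)
    fix x assume "x \<in> space M"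
    then have "cmod (v x) powr r \<le> (c * cmod (w x)) powr r"
      using vw r by (intro powr_mono2) auto
    then show "ennreal (cmod (v x) powr r) \<le> ennreal (c powr r) * ennreal (cmod (w x) powr r)"
      using cd by (simp add: powr_mult flip: ennreal_mult)
  qed
  also have "\<dots> = ennreal (c powr r) * (\<integral>\<^sup>+x. ennreal (cmod (w x) powr r) \<partial>M)"
    by (rule nn_integral_cmult) simp
  also have "\<dots> \<le> ennreal (c powr r) * ennreal (d powr r)"
    using w r cd by (intro mult_left_mono) (auto simp: Lp_norm_le_iff)
  also have "\<dots> = ennreal ((c * d) powr r)" using cd by (simp add: powr_mult ennreal_mult)
  finally show ?thesis using r cd by (simp add: Lp_norm_le_iff)
qed

lemma holder_related_exponent:
  assumes "holder_related p1 p2 p3"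
  shows "p1 = \<infinity> \<or> (\<exists>r>0. p1 = ennreal r)" "p2 = \<infinity> \<or> (\<exists>r>0. p2 = ennreal r)"
    "p3 = \<infinity> \<or> (\<exists>r>0. p3 = ennreal r)"
proof -
  have pos: "r \<ge> 1 \<Longrightarrow> r > 0" for r :: real by simp
  show "p1 = \<infinity> \<or> (\<exists>r>0. p1 = ennreal r)"
    using assms by (cases rule: holder_related_cases) (use pos in blast)+
  show "p2 = \<infinity> \<or> (\<exists>r>0. p2 = ennreal r)"
    using assms by (cases rule: holder_related_cases) (use pos in blast)+
  show "p3 = \<infinity> \<or> (\<exists>r>0. p3 = ennreal r)"
    using assms by (cases rule: holder_related_cases) (use pos in blast)+
qed

text \<open>Test the multiplier on a pair of characters.\<close>

lemma multiplier_bounded: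
  assumes h: "holder_related p1 p2 p3" and b: "bound_T p1 p2 p3 \<phi> C"
  shows "cmod (\<phi> (n, m)) \<le> C"
proof -
  let ?F = "\<lambda>n x. \<Sum>n\<in>{n}. 1 * character n x"
  have C: "C \<ge> 0" using b by (simp add: bound_T_def)
  have n1: "Lp_norm p torus (?F n) = ennreal 1" if "p = \<infinity> \<or> (\<exists>r>0. p = ennreal r)" for p n
    using that by (intro Lp_norm_torus_const) auto
  have "bilin_T \<phi> (?F n) (?F m) = (\<lambda>x. \<phi> (n, m) * character n x * character m x)"
    by (rule ext) (simp only: bilin_T_trig_poly finite.intros; simp)
  moreover have "Lp_norm p3 torus (\<lambda>x. \<phi> (n, m) * character n x * character m x) = ennreal (cmod (\<phi> (n, m)))"
    using holder_related_exponent[OF h] by (intro Lp_norm_torus_const) (auto simp: norm_mult)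
  moreover have "Lp_norm p3 torus (bilin_T \<phi> (?F n) (?F m)) \<le> ennreal C * Lp_norm p1 torus (?F n) * Lp_norm p2 torus (?F m)"
    using b trig_poly_in_trig_polys[of "{n}" "\<lambda>_. 1"] trig_poly_in_trig_polys[of "{m}" "\<lambda>_. 1"]
    unfolding bound_T_def by blast
  ultimately have "ennreal (cmod (\<phi> (n, m))) \<le> ennreal C * ennreal 1 * ennreal 1"
    by (simp only: n1 holder_related_exponent[OF h])
  then show ?thesis using C by simp
qed

lemma tent_eq: "tent (x, y) = tri x * tri y"
  by (auto simp: tent_def tri_def max_def)

text \<open>The integers whose triangles can be nonzero at \<open>x\<close>.\<close>

definition adjacent_ints :: "real \<Rightarrow> int set" where
  "adjacent_ints x = {\<lfloor>x\<rfloor>, \<lfloor>x\<rfloor> + 1}"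

lemma tri_support: "tri (x - of_int n) \<noteq> 0 \<Longrightarrow> n \<in> adjacent_ints x"
proof (rule ccontr)
  assume "n \<notin> adjacent_ints x"
  then have "n < \<lfloor>x\<rfloor> \<or> n > \<lfloor>x\<rfloor> + 1" by (auto simp: adjacent_ints_def)
  then have "1 \<le> \<bar>x - of_int n\<bar>" by linarith
  moreover assume "tri (x - of_int n) \<noteq> 0"
  ultimately show False using tri_eq_0 by blast
qed

lemma tri_partition: "(\<Sum>n\<in>adjacent_ints x. tri (x - of_int n)) = 1"
proof -
  have "tri (x - of_int \<lfloor>x\<rfloor>) = 1 - (x - of_int \<lfloor>x\<rfloor>)" "tri (x - of_int (\<lfloor>x\<rfloor> + 1)) = x - of_int \<lfloor>x\<rfloor>"
    unfolding tri_def by linarith+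
  then show ?thesis by (simp add: adjacent_ints_def)
qed

lemma finite_adjacent_ints [simp]: "finite (adjacent_ints x)"
  by (simp add: adjacent_ints_def)

text \<open>Approximates \<^const>\<open>tent_extension\<close> by finitely many tents. The weights are those of the Fejer
  means, so that on the torus this truncation amounts to replacing functions by their Fejer means.\<close>

definition fejer_extension :: "(int \<times> int \<Rightarrow> complex) \<Rightarrow> nat \<Rightarrow> real \<times> real \<Rightarrow> complex" where
  "fejer_extension \<phi> N = (\<lambda>(\<xi>, \<eta>). \<Sum>n\<in>{-int N..int N}. \<Sum>m\<in>{-int N..int N}.
     (of_real (fejer_weight N n * fejer_weight N m) * \<phi> (n, m)) * of_real (tri (\<xi> - of_int n) * tri (\<eta> - of_int m)))"

lemma tent_extension_finite_sum:
  "tent_extension \<phi> (\<xi>, \<eta>)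
    = (\<Sum>n\<in>adjacent_ints \<xi>. \<Sum>m\<in>adjacent_ints \<eta>. \<phi> (n, m) * of_real (tri (\<xi> - of_int n) * tri (\<eta> - of_int m)))"
proof -
  have "tent_extension \<phi> (\<xi>, \<eta>)
    = (\<Sum>\<^sub>\<infinity>(n, m)\<in>adjacent_ints \<xi> \<times> adjacent_ints \<eta>. \<phi> (n, m) * of_real (tri (\<xi> - of_int n) * tri (\<eta> - of_int m)))"
    unfolding tent_extension_def prod.case tent_eq
    by (intro infsum_cong_neutral) (auto dest: tri_support)
  also have "\<dots> = (\<Sum>(n, m)\<in>adjacent_ints \<xi> \<times> adjacent_ints \<eta>. \<phi> (n, m) * of_real (tri (\<xi> - of_int n) * tri (\<eta> - of_int m)))"
    by (intro infsum_finite) auto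
  finally show ?thesis by (simp add: sum.cartesian_product)
qed

lemma fejer_weight_support:
  assumes "N > 0" "fejer_weight N n \<noteq> 0"
  shows "n \<in> {-int N..int N}"
proof -
  have "1 - \<bar>real_of_int n\<bar> / real N > 0"
    using assms(2) by (auto simp only: fejer_weight_def max_def split: if_splits)
  then have "\<bar>real_of_int n\<bar> < real N" using assms(1) by (simp add: field_simps)
  then show ?thesis by auto
qed

lemma fejer_extension_finite_sum:
  assumes N: "N > 0"
  shows "fejer_extension \<phi> N (\<xi>, \<eta>) = (\<Sum>n\<in>adjacent_ints \<xi>. \<Sum>m\<in>adjacent_ints \<eta>.
     (of_real (fejer_weight N n * fejer_weight N m) * \<phi> (n, m)) * of_real (tri (\<xi> - of_int n) * tri (\<eta> - of_int m)))"
proof -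
  let ?g = "\<lambda>(n, m). (of_real (fejer_weight N n * fejer_weight N m) * \<phi> (n, m)) * of_real (tri (\<xi> - of_int n) * tri (\<eta> - of_int m)) :: complex"
  let ?I = "{-int N..int N}"
  have "sum ?g (?I \<times> ?I) = sum ?g ((?I \<inter> adjacent_ints \<xi>) \<times> (?I \<inter> adjacent_ints \<eta>))"
    by (rule sum.mono_neutral_right) (auto dest: tri_support)
  also have "\<dots> = sum ?g (adjacent_ints \<xi> \<times> adjacent_ints \<eta>)"
    by (intro sum.mono_neutral_left) (use fejer_weight_support[OF N] in fastforce)+
  finally show ?thesis by (simp add: fejer_extension_def sum.cartesian_product)
qed

lemma fejer_extension_tendsto:
  "(\<lambda>N. fejer_extension \<phi> (Suc N) z) \<longlonglongrightarrow> tent_extension \<phi> z"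
proof (cases z)
  case (Pair \<xi> \<eta>)
  have w: "(\<lambda>N. fejer_weight (Suc N) n) \<longlonglongrightarrow> 1" for n
    by (rule LIMSEQ_Suc[OF fejer_weight_tendsto])
  have "(\<lambda>N. fejer_extension \<phi> (Suc N) (\<xi>, \<eta>)) \<longlonglongrightarrow> (\<Sum>n\<in>adjacent_ints \<xi>. \<Sum>m\<in>adjacent_ints \<eta>.
     (of_real (1 * 1) * \<phi> (n, m)) * of_real (tri (\<xi> - of_int n) * tri (\<eta> - of_int m)))"
    unfolding fejer_extension_finite_sum[OF zero_less_Suc] by (intro tendsto_intros w)
  then show ?thesis using Pair by (simp add: tent_extension_finite_sum)
qed

text \<open>The triangles form a partition of unity and the weights are at most 1.\<close>

lemma fejer_extension_bounded:
  assumes N: "N > 0" and \<phi>: "\<And>n m. cmod (\<phi> (n, m)) \<le> C"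
  shows "cmod (fejer_extension \<phi> N z) \<le> C"
proof (cases z)
  case (Pair \<xi> \<eta>)
  have "cmod (fejer_extension \<phi> N (\<xi>, \<eta>)) \<le> (\<Sum>n\<in>adjacent_ints \<xi>. \<Sum>m\<in>adjacent_ints \<eta>. C * (tri (\<xi> - of_int n) * tri (\<eta> - of_int m)))"
    unfolding fejer_extension_finite_sum[OF N]
  proof (intro sum_norm_le)
    fix n m
    have "cmod ((of_real (fejer_weight N n * fejer_weight N m) * \<phi> (n, m)) * of_real (tri (\<xi> - of_int n) * tri (\<eta> - of_int m)))
      = (fejer_weight N n * fejer_weight N m) * cmod (\<phi> (n, m)) * (tri (\<xi> - of_int n) * tri (\<eta> - of_int m))"
      by (simp add: norm_mult fejer_weight_nonneg tri_nonneg)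
    also have "\<dots> \<le> 1 * C * (tri (\<xi> - of_int n) * tri (\<eta> - of_int m))"
      by (intro mult_right_mono mult_mono \<phi> mult_le_one)
         (auto simp: fejer_weight_nonneg tri_nonneg fejer_weight_le_1)
    finally show "cmod ((of_real (fejer_weight N n * fejer_weight N m) * \<phi> (n, m)) * of_real (tri (\<xi> - of_int n) * tri (\<eta> - of_int m)))
      \<le> C * (tri (\<xi> - of_int n) * tri (\<eta> - of_int m))" by simp
  qed
  also have "\<dots> = C * ((\<Sum>n\<in>adjacent_ints \<xi>. tri (\<xi> - of_int n)) * (\<Sum>m\<in>adjacent_ints \<eta>. tri (\<eta> - of_int m)))"
    unfolding sum_product by (simp add: sum_distrib_left)
  finally show ?thesis using Pair by (simp add: tri_partition)
qed

lemma fejer_extension_measurable [measurable]: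
  "fejer_extension \<phi> N \<in> borel_measurable borel"
proof -
  have "(\<lambda>z. \<Sum>n\<in>{-int N..int N}. \<Sum>m\<in>{-int N..int N}.
     (of_real (fejer_weight N n * fejer_weight N m) * \<phi> (n, m)) * of_real (tri (fst z - of_int n) * tri (snd z - of_int m)))
     \<in> borel_measurable (borel \<Otimes>\<^sub>M borel :: (real \<times> real) measure)"
    by measurable
  then show ?thesis by (simp add: fejer_extension_def case_prod_beta' borel_prod)
qed

lemma tent_extension_measurable: "tent_extension \<phi> \<in> borel_measurable borel"
  by (rule borel_measurable_LIMSEQ_metric[OF fejer_extension_measurable fejer_extension_tendsto])

lemma tent_extension_bounded:
  assumes "\<And>n m. cmod (\<phi> (n, m)) \<le> C"
  shows "cmod (tent_extension \<phi> z) \<le> C"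
  by (rule Lim_norm_ubound[OF _ fejer_extension_tendsto])
     (auto intro!: always_eventually fejer_extension_bounded assms)

lemma tent_extension_L_infinity:
  assumes \<phi>: "\<And>n m. cmod (\<phi> (n, m)) \<le> C"
  shows "tent_extension \<phi> \<in> L_infinity lebesgue"
proof -
  have m: "tent_extension \<phi> \<in> borel_measurable lebesgue"
    using tent_extension_measurable by (intro measurable_completion) simp
  have "Lp_norm \<infinity> lebesgue (tent_extension \<phi>) \<le> ennreal C"
    using m by (rule Lp_norm_infinity_leI) (intro AE_I2 tent_extension_bounded \<phi>)
  also have "\<dots> < \<infinity>" by simp
  finally show ?thesis using m by (simp add: L_infinity_def)
qed

section \<open>The bilinear operator\<close>

lemma borel_measurable_swap:
  fixes h :: "real \<times> real \<Rightarrow> complex"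
  assumes "h \<in> borel_measurable borel"
  shows "(\<lambda>(\<eta>, \<xi>). h (\<xi>, \<eta>)) \<in> borel_measurable (borel \<Otimes>\<^sub>M borel)"
  using assms by (intro measurable_pair_swap) (simp add: borel_prod)

lemma borel_measurable_section:
  fixes h :: "real \<times> real \<Rightarrow> complex"
  assumes "h \<in> borel_measurable borel"
  shows "(\<lambda>\<xi>. h (\<xi>, \<eta>)) \<in> borel_measurable borel"
  by (rule measurable_compose[OF _ assms])
     (intro borel_measurable_continuous_onI continuous_intros)

lemma bilin_R_lborel:
  assumes f: "f \<in> schwartz" and g: "g \<in> schwartz" and [measurable]: "\<psi> \<in> borel_measurable borel"
  shows "bilin_R \<psi> f g x = (LINT \<eta>|lborel. LINT \<xi>|lborel.
        fourier f \<xi> * fourier g \<eta> * \<psi> (\<xi>, \<eta>) * cis (2 * pi * x * (\<xi> + \<eta>)))"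
proof -
  note [measurable] = fourier_measurable[OF schwartz_borel[OF f]] fourier_measurable[OF schwartz_borel[OF g]]
  note [measurable] = borel_measurable_swap[OF assms(3)] borel_measurable_section[OF assms(3)]
  have "bilin_R \<psi> f g x = (LINT \<eta>|lebesgue. LINT \<xi>|lborel.
        fourier f \<xi> * fourier g \<eta> * \<psi> (\<xi>, \<eta>) * cis (2 * pi * x * (\<xi> + \<eta>)))"
    unfolding bilin_R_def
    by (intro Bochner_Integration.integral_cong refl integral_completion) measurable
  also have "\<dots> = (LINT \<eta>|lborel. LINT \<xi>|lborel.
        fourier f \<xi> * fourier g \<eta> * \<psi> (\<xi>, \<eta>) * cis (2 * pi * x * (\<xi> + \<eta>)))"
    by (rule integral_completion) measurable
  finally show ?thesis .
qed

text \<open>Dominated convergence in both variables, with the integrable majorant given by the product of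
  the two Fourier transforms.\<close>

lemma bilin_R_tendsto:
  assumes f: "f \<in> schwartz" and g: "g \<in> schwartz"
    and m[measurable]: "\<And>N. \<psi> N \<in> borel_measurable borel" and lim: "\<And>z. (\<lambda>N. \<psi> N z) \<longlonglongrightarrow> \<psi>' z"
    and bound: "\<And>N z. cmod (\<psi> N z) \<le> C"
  shows "(\<lambda>N. bilin_R (\<psi> N) f g x) \<longlonglongrightarrow> bilin_R \<psi>' f g x"
proof -
  note [measurable] = fourier_measurable[OF schwartz_borel[OF f]] fourier_measurable[OF schwartz_borel[OF g]]
  have m'[measurable]: "\<psi>' \<in> borel_measurable borel" by (rule borel_measurable_LIMSEQ_metric[OF m lim])
  note [measurable] = borel_measurable_swap[OF m] borel_measurable_swap[OF m']
    borel_measurable_section[OF m] borel_measurable_section[OF m']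
  have bF: "cmod (fourier f \<xi> * fourier g \<eta> * \<psi> N (\<xi>, \<eta>) * cis (2 * pi * x * (\<xi> + \<eta>)))
      \<le> C * cmod (fourier g \<eta>) * cmod (fourier f \<xi>)" for N \<xi> \<eta>
    using mult_left_mono[OF bound[of N "(\<xi>, \<eta>)"], of "cmod (fourier g \<eta>) * cmod (fourier f \<xi>)"]
    by (simp add: norm_mult mult_ac)
  have inner_int: "integrable lborel (\<lambda>\<xi>. C * cmod (fourier g \<eta>) * cmod (fourier f \<xi>))" for \<eta>
    using integrable_fourier_schwartz[OF f] by (intro integrable_mult_right integrable_norm)
  show ?thesis
    unfolding bilin_R_lborel[OF f g m] bilin_R_lborel[OF f g m']
  proof (rule integral_dominated_convergence)
    show "integrable lborel (\<lambda>\<eta>. C * (LINT \<xi>|lborel. cmod (fourier f \<xi>)) * cmod (fourier g \<eta>))"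
      using integrable_fourier_schwartz[OF g] by (intro integrable_mult_right integrable_norm)
    show "AE \<eta> in lborel. (\<lambda>N. LINT \<xi>|lborel. fourier f \<xi> * fourier g \<eta> * \<psi> N (\<xi>, \<eta>) * cis (2 * pi * x * (\<xi> + \<eta>)))
        \<longlonglongrightarrow> (LINT \<xi>|lborel. fourier f \<xi> * fourier g \<eta> * \<psi>' (\<xi>, \<eta>) * cis (2 * pi * x * (\<xi> + \<eta>)))"
    proof (rule AE_I2)
      fix \<eta>
      show "(\<lambda>N. LINT \<xi>|lborel. fourier f \<xi> * fourier g \<eta> * \<psi> N (\<xi>, \<eta>) * cis (2 * pi * x * (\<xi> + \<eta>)))
        \<longlonglongrightarrow> (LINT \<xi>|lborel. fourier f \<xi> * fourier g \<eta> * \<psi>' (\<xi>, \<eta>) * cis (2 * pi * x * (\<xi> + \<eta>)))"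
      proof (rule integral_dominated_convergence[OF _ _ inner_int[of \<eta>]])
        show "AE \<xi> in lborel. (\<lambda>N. fourier f \<xi> * fourier g \<eta> * \<psi> N (\<xi>, \<eta>) * cis (2 * pi * x * (\<xi> + \<eta>)))
          \<longlonglongrightarrow> fourier f \<xi> * fourier g \<eta> * \<psi>' (\<xi>, \<eta>) * cis (2 * pi * x * (\<xi> + \<eta>))"
          by (intro AE_I2 tendsto_intros lim)
      qed (measurable, intro AE_I2 bF)
    qed
    show "AE \<eta> in lborel. cmod (LINT \<xi>|lborel. fourier f \<xi> * fourier g \<eta> * \<psi> N (\<xi>, \<eta>) * cis (2 * pi * x * (\<xi> + \<eta>)))
       \<le> C * (LINT \<xi>|lborel. cmod (fourier f \<xi>)) * cmod (fourier g \<eta>)" for N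
    proof (rule AE_I2)
      fix \<eta>
      let ?h = "\<lambda>\<xi>. fourier f \<xi> * fourier g \<eta> * \<psi> N (\<xi>, \<eta>) * cis (2 * pi * x * (\<xi> + \<eta>))"
      have "integrable lborel (\<lambda>\<xi>. cmod (?h \<xi>))"
        by (rule Bochner_Integration.integrable_bound[OF inner_int[of \<eta>]])
           (measurable, use bF in \<open>auto intro!: AE_I2 intro: order_trans[OF _ abs_ge_self]\<close>)
      then have "(LINT \<xi>|lborel. cmod (?h \<xi>)) \<le> (LINT \<xi>|lborel. C * cmod (fourier g \<eta>) * cmod (fourier f \<xi>))"
        by (rule integral_mono[OF _ inner_int bF])
      then have "cmod (LINT \<xi>|lborel. ?h \<xi>) \<le> (LINT \<xi>|lborel. C * cmod (fourier g \<eta>) * cmod (fourier f \<xi>))"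
        by (rule order_trans[OF integral_norm_bound])
      also have "\<dots> = C * (LINT \<xi>|lborel. cmod (fourier f \<xi>)) * cmod (fourier g \<eta>)" by simp
      finally show "cmod (LINT \<xi>|lborel. ?h \<xi>) \<le> C * (LINT \<xi>|lborel. cmod (fourier f \<xi>)) * cmod (fourier g \<eta>)" .
    qed
  qed measurable
qed

lemma bilin_R_fejer_extension:
  assumes f: "f \<in> schwartz" and g: "g \<in> schwartz"
  shows "bilin_R (fejer_extension \<phi> N) f g x = (\<Sum>n\<in>{-int N..int N}. \<Sum>m\<in>{-int N..int N}.
     (of_real (fejer_weight N n * fejer_weight N m) * \<phi> (n, m)) * (frequency_piece f 0 x n * frequency_piece g 0 x m))"
proof -
  define c where "c n m = of_real (fejer_weight N n * fejer_weight N m) * \<phi> (n, m)" for n m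
  define P where "P f n \<xi> = fourier f \<xi> * of_real (tri (\<xi> - of_int n) * (\<xi> - of_int n) ^ 0) * cis (2 * pi * x * \<xi>)" for f n \<xi>
  have P: "integrable lborel (P f n)" "integrable lborel (P g n)" for n
    unfolding P_def by (intro frequency_piece_integrable f g)+
  have split: "fourier f \<xi> * fourier g \<eta> * fejer_extension \<phi> N (\<xi>, \<eta>) * cis (2 * pi * x * (\<xi> + \<eta>))
      = (\<Sum>n\<in>{-int N..int N}. \<Sum>m\<in>{-int N..int N}. c n m * P g m \<eta> * P f n \<xi>)" for \<xi> \<eta>
  proof -
    have "cis (2 * pi * x * (\<xi> + \<eta>)) = cis (2 * pi * x * \<xi>) * cis (2 * pi * x * \<eta>)"
      by (simp add: cis_mult distrib_left)
    then show ?thesis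
      unfolding fejer_extension_def prod.case sum_distrib_left sum_distrib_right
      by (intro sum.cong refl) (simp add: c_def P_def mult_ac)
  qed
  have "bilin_R (fejer_extension \<phi> N) f g x
      = (LINT \<eta>|lborel. (\<Sum>n\<in>{-int N..int N}. \<Sum>m\<in>{-int N..int N}. c n m * P g m \<eta> * (LINT \<xi>|lborel. P f n \<xi>)))"
    unfolding bilin_R_lborel[OF f g fejer_extension_measurable] split
    using P by (subst Bochner_Integration.integral_sum; (intro Bochner_Integration.integrable_sum integrable_mult_right)?;
      subst Bochner_Integration.integral_sum | simp)+
  also have "\<dots> = (\<Sum>n\<in>{-int N..int N}. \<Sum>m\<in>{-int N..int N}. c n m * (LINT \<eta>|lborel. P g m \<eta>) * (LINT \<xi>|lborel. P f n \<xi>))"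
    using P by (simp add: Bochner_Integration.integral_sum)
  finally show ?thesis by (simp add: c_def P_def[abs_def] frequency_piece_def mult_ac)
qed

section \<open>From the torus to the line\<close>

lemma bilin_T_fejer_poly:
  "bilin_T \<phi> (fejer_poly f N k a) (fejer_poly g N k b) t
    = (\<Sum>n\<in>{-int N..int N}. \<Sum>m\<in>{-int N..int N}. (of_real (fejer_weight N n * fejer_weight N m) * \<phi> (n, m))
      * ((frequency_piece f a (of_int k) n * character n t) * (frequency_piece g b (of_int k) m * character m t)))"
  unfolding fejer_poly_def[abs_def]
  by (subst bilin_T_trig_poly) (auto simp: mult_ac)

text \<open>The \<open>(a, b)\<close> term of the product of the two Taylor series, at \<open>x = k + t\<close> with \<open>k\<close> the integer nearest
  to \<open>x\<close>. It is a function of \<open>t\<close> bounded by \<open>pi ^ (a + b) / (fact a * fact b)\<close>, times the value at the same point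
  \<open>t\<close> of the torus operator applied to two trigonometric polynomials that depend on \<open>k\<close> only.\<close>

definition block_term :: "(int \<times> int \<Rightarrow> complex) \<Rightarrow> (real \<Rightarrow> complex) \<Rightarrow> (real \<Rightarrow> complex) \<Rightarrow> nat \<Rightarrow> nat \<Rightarrow> nat \<Rightarrow> real \<Rightarrow> complex" where
  "block_term \<phi> f g N a b x =
     (let k = \<lfloor>x + 1 / 2\<rfloor>; t = x - of_int k in
      (2 * pi * \<i> * of_real t) ^ a / fact a * ((2 * pi * \<i> * of_real t) ^ b / fact b)
      * bilin_T \<phi> (fejer_poly f N k a) (fejer_poly g N k b) t)"

lemma block_term_measurable:
  assumes f: "f \<in> schwartz" and g: "g \<in> schwartz"
  shows "block_term \<phi> f g N a b \<in> borel_measurable borel"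
proof -
  note [measurable] = frequency_piece_measurable[OF f] frequency_piece_measurable[OF g]
  show ?thesis unfolding block_term_def Let_def bilin_T_fejer_poly character_def by measurable
qed

lemma double_sum_tendsto:
  fixes c :: "'i \<Rightarrow> 'j \<Rightarrow> complex"
  assumes "\<And>n. (\<lambda>a. p a n) sums P n" "\<And>m. (\<lambda>b. q b m) sums Q m"
  shows "(\<lambda>M. \<Sum>a<M. \<Sum>b<M. \<Sum>n\<in>A. \<Sum>m\<in>B. c n m * (p a n * q b m))
      \<longlonglongrightarrow> (\<Sum>n\<in>A. \<Sum>m\<in>B. c n m * (P n * Q m))"
proof -
  have "(\<Sum>a<M. \<Sum>b<M. \<Sum>n\<in>A. \<Sum>m\<in>B. c n m * (p a n * q b m))
      = (\<Sum>n\<in>A. \<Sum>m\<in>B. c n m * ((\<Sum>a<M. p a n) * (\<Sum>b<M. q b m)))" for M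
  proof -
    have "(\<Sum>a<M. \<Sum>b<M. \<Sum>n\<in>A. \<Sum>m\<in>B. c n m * (p a n * q b m))
        = (\<Sum>a<M. \<Sum>n\<in>A. \<Sum>b<M. \<Sum>m\<in>B. c n m * (p a n * q b m))"
      by (intro sum.cong refl sum.swap)
    also have "\<dots> = (\<Sum>n\<in>A. \<Sum>a<M. \<Sum>b<M. \<Sum>m\<in>B. c n m * (p a n * q b m))"
      by (rule sum.swap)
    also have "\<dots> = (\<Sum>n\<in>A. \<Sum>a<M. \<Sum>m\<in>B. \<Sum>b<M. c n m * (p a n * q b m))"
      by (intro sum.cong refl sum.swap)
    also have "\<dots> = (\<Sum>n\<in>A. \<Sum>m\<in>B. \<Sum>a<M. \<Sum>b<M. c n m * (p a n * q b m))"
      by (intro sum.cong refl sum.swap)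
    also have "\<dots> = (\<Sum>n\<in>A. \<Sum>m\<in>B. c n m * ((\<Sum>a<M. p a n) * (\<Sum>b<M. q b m)))"
      by (simp only: sum_product) (simp only: sum_distrib_left)
    finally show ?thesis .
  qed
  then show ?thesis
    using assms by (simp only:) (intro tendsto_intros; simp add: sums_def)
qed

lemma bilin_R_fejer_extension_series:
  assumes f: "f \<in> schwartz" and g: "g \<in> schwartz"
  shows "(\<lambda>M. \<Sum>a<M. \<Sum>b<M. block_term \<phi> f g N a b x) \<longlonglongrightarrow> bilin_R (fejer_extension \<phi> N) f g x"
proof -
  define k where "k = \<lfloor>x + 1 / 2\<rfloor>"
  define t where "t = x - of_int k"
  have x: "x = of_int k + t" by (simp add: t_def)
  have bt: "block_term \<phi> f g N a b x = (\<Sum>n\<in>{-int N..int N}. \<Sum>m\<in>{-int N..int N}. (of_real (fejer_weight N n * fejer_weight N m) * \<phi> (n, m))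
      * (((2 * pi * \<i> * of_real t) ^ a / fact a * frequency_piece f a (of_int k) n * character n t)
       * ((2 * pi * \<i> * of_real t) ^ b / fact b * frequency_piece g b (of_int k) m * character m t)))" for a b
    unfolding block_term_def Let_def k_def[symmetric] t_def[symmetric] bilin_T_fejer_poly sum_distrib_left
    by (intro sum.cong refl) (simp only: mult_ac)
  show ?thesis
    unfolding bt bilin_R_fejer_extension[OF f g]
    by (rule double_sum_tendsto) (simp_all only: x frequency_piece_taylor f g)
qed

text \<open>This provides the pointwise hypothesis of \<open>Lp_norm_double_series\<close>; 4 is the square of the sum of the
  geometric series with ratio 1/2.\<close>

lemma norm_le_of_geometric_terms:
  fixes u :: "nat \<Rightarrow> nat \<Rightarrow> complex"
  assumes lim: "(\<lambda>M. \<Sum>a<M. \<Sum>b<M. u a b) \<longlonglongrightarrow> s" and S: "\<And>a b. 2 ^ (a + b) * cmod (u a b) \<le> S"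
  shows "cmod s \<le> 4 * S"
proof (rule Lim_norm_ubound[OF _ lim])
  have "cmod (u 0 0) \<le> S" using S[of 0 0] by simp
  then have S0: "S \<ge> 0" using norm_ge_zero order_trans by blast
  have geo: "(\<Sum>a<M. (1 / 2) ^ a) \<le> (2::real)" for M
    by (simp add: geometric_sum)
  have "cmod (\<Sum>a<M. \<Sum>b<M. u a b) \<le> 4 * S" for M
  proof -
    have "cmod (\<Sum>a<M. \<Sum>b<M. u a b) \<le> (\<Sum>a<M. \<Sum>b<M. S * ((1 / 2) ^ a * (1 / 2) ^ b))"
    proof (intro sum_norm_le)
      fix a b
      show "cmod (u a b) \<le> S * ((1 / 2) ^ a * (1 / 2) ^ b)"
        using S[of a b] by (simp add: field_simps power_add)
    qed
    also have "\<dots> = S * ((\<Sum>a<M. (1 / 2) ^ a) * (\<Sum>b<M. (1 / 2) ^ b))"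
      unfolding sum_product by (simp add: sum_distrib_left)
    also have "\<dots> \<le> S * (2 * 2)"
      by (intro mult_left_mono mult_mono geo S0) (auto intro: sum_nonneg)
    finally show ?thesis by simp
  qed
  then show "eventually (\<lambda>M. cmod (\<Sum>a<M. \<Sum>b<M. u a b) \<le> 4 * S) sequentially"
    by simp
qed simp

lemma power_over_fact_le:
  fixes R :: real
  assumes "R \<ge> 0"
  shows "R ^ a / fact a \<le> exp (4 * R) * (1 / 4) ^ a"
proof -
  have "(4 * R) ^ a / fact a \<le> exp (4 * R)"
  proof -
    have s: "(\<lambda>n. (4 * R) ^ n / fact n) sums exp (4 * R)"
      using exp_converges[of "4 * R"] by (simp add: divide_inverse mult.commute)
    have "(\<Sum>n\<in>{a}. (4 * R) ^ n / fact n) \<le> (\<Sum>n. (4 * R) ^ n / fact n)"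
      using s assms by (intro sum_le_suminf) (auto simp: sums_iff)
    then show ?thesis using s by (simp add: sums_iff)
  qed
  then have "(4 * R) ^ a / fact a * (1 / 4) ^ a \<le> exp (4 * R) * (1 / 4) ^ a"
    by (rule mult_right_mono) simp
  moreover have "(4 * R) ^ a * (1 / 4) ^ a = R ^ a"
    by (subst power_mult_distrib[symmetric]) simp
  ultimately show ?thesis by (simp add: field_simps)
qed

definition tent_constant :: real where
  "tent_constant = (10 * decay_mass * exp (16 * pi))\<^sup>2"

lemma holder_related_ge_1: "holder_related p1 p2 p3 \<Longrightarrow> p1 \<ge> 1 \<and> p2 \<ge> 1"
  by (simp add: holder_related_def)

text \<open>On each block apply the multiplier bound on the torus, then Hoelder's inequality for the sum
  over the blocks. The factorials make the result decay like \<open>4 ^ - (i + j)\<close>.\<close>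

lemma block_term_Lp_norm:
  assumes h: "holder_related p1 p2 p3" and b: "bound_T p1 p2 p3 \<phi> C"
    and f: "f \<in> schwartz" and g: "g \<in> schwartz" and N: "N > 0"
  shows "Lp_norm p3 lebesgue (block_term \<phi> f g N i j)
    \<le> ennreal (tent_constant * C * enn2real (Lp_norm p1 lebesgue f) * enn2real (Lp_norm p2 lebesgue g) * (1 / 4) ^ (i + j))"
proof -
  define nf where "nf = enn2real (Lp_norm p1 lebesgue f)"
  define ng where "ng = enn2real (Lp_norm p2 lebesgue g)"
  have C: "C \<ge> 0" using b by (simp add: bound_T_def)
  have p: "p1 \<ge> 1" "p2 \<ge> 1" using holder_related_ge_1[OF h] by auto
  note p3 = holder_related_exponent(3)[OF h]
  obtain x where x: "\<And>k. x k \<ge> 0" "\<And>k. Lp_norm p1 torus (fejer_poly f N k i) \<le> ennreal (x k)"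
    "Lp_norm p1 (count_space UNIV) (\<lambda>k. complex_of_real (x k)) \<le> ennreal (10 * 4 ^ i * decay_mass * nf)"
    using fejer_poly_Lp_norm[OF f N p(1), of i] unfolding nf_def by blast
  obtain y where y: "\<And>k. y k \<ge> 0" "\<And>k. Lp_norm p2 torus (fejer_poly g N k j) \<le> ennreal (y k)"
    "Lp_norm p2 (count_space UNIV) (\<lambda>k. complex_of_real (y k)) \<le> ennreal (10 * 4 ^ j * decay_mass * ng)"
    using fejer_poly_Lp_norm[OF g N p(2), of j] unfolding ng_def by blast
  define X where "X = 10 * 4 ^ i * decay_mass * nf"
  define Y where "Y = 10 * 4 ^ j * decay_mass * ng"
  have XY: "X \<ge> 0" "Y \<ge> 0" using decay_mass_pos by (auto simp: X_def Y_def nf_def ng_def)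
  define w where "w = pi ^ i / fact i * (pi ^ j / fact j)"
  have w: "w \<ge> 0" by (simp add: w_def)
  define B where "B k = bilin_T \<phi> (fejer_poly f N k i) (fejer_poly g N k j)" for k
  have B_meas: "B k \<in> borel_measurable borel" for k
  proof -
    have "B k = (\<lambda>t. bilin_T \<phi> (fejer_poly f N k i) (fejer_poly g N k j) t)" by (simp add: B_def)
    also have "\<dots> \<in> borel_measurable borel" unfolding bilin_T_fejer_poly by measurable
    finally show ?thesis .
  qed
  have B_norm: "Lp_norm p3 torus (B k) \<le> ennreal (C * x k * y k)" for k
  proof -
    have "fejer_poly f N k i \<in> trig_polys" "fejer_poly g N k j \<in> trig_polys"
      unfolding fejer_poly_def[abs_def] by (intro trig_poly_in_trig_polys; simp)+
    then have "Lp_norm p3 torus (B k) \<le> ennreal C * Lp_norm p1 torus (fejer_poly f N k i) * Lp_norm p2 torus (fejer_poly g N k j)"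
      using b unfolding bound_T_def B_def by blast
    also have "\<dots> \<le> ennreal C * ennreal (x k) * ennreal (y k)"
      by (intro mult_mono x y) auto
    finally show ?thesis using C x y by (simp add: ennreal_mult)
  qed
  have count: "Lp_norm p3 (count_space UNIV) (\<lambda>k. complex_of_real (x k) * complex_of_real (y k)) \<le> ennreal (X * Y)"
    using x y XY by (intro Holder_inequality[OF h]) (auto simp: X_def Y_def)
  have "Lp_norm p3 lebesgue (block_term \<phi> f g N i j) \<le> ennreal ((w * C) * (X * Y))"
  proof (rule Lp_norm_blocks[OF p3 block_term_measurable[OF f g]])
    fix k :: int
    have "Lp_norm p3 torus (\<lambda>t. block_term \<phi> f g N i j (of_int k + t)) \<le> ennreal (w * (C * x k * y k))"
    proof (rule Lp_norm_dominated[OF p3 _ _ _ w _ B_norm])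
      show "(\<lambda>t. block_term \<phi> f g N i j (of_int k + t)) \<in> borel_measurable torus"
        by (rule borel_measurable_torus, rule measurable_compose[OF _ block_term_measurable[OF f g]]) measurable
      show "B k \<in> borel_measurable torus" by (rule borel_measurable_torus[OF B_meas])
      show "C * x k * y k \<ge> 0" using C x y by simp
      fix t assume "t \<in> space torus"
      then have t: "- 1 / 2 \<le> t" "t < 1 / 2" by auto
      have fl: "\<lfloor>of_int k + t + 1 / 2\<rfloor> = k" using t by (intro floor_unique) auto
      have z: "cmod ((2 * pi * \<i> * of_real t) ^ c / fact c) \<le> pi ^ c / fact c" for c
      proof -
        have "cmod (2 * pi * \<i> * of_real t) = 2 * \<bar>t\<bar> * pi" by (simp add: norm_mult)
        also have "\<dots> \<le> 1 * pi" using t by (intro mult_right_mono) auto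
        finally have "cmod (2 * pi * \<i> * of_real t) ^ c \<le> pi ^ c" by (intro power_mono) auto
        then show ?thesis by (simp add: norm_divide norm_power divide_right_mono)
      qed
      have "cmod (block_term \<phi> f g N i j (of_int k + t))
        = cmod ((2 * pi * \<i> * of_real t) ^ i / fact i) * cmod ((2 * pi * \<i> * of_real t) ^ j / fact j) * cmod (B k t)"
        unfolding block_term_def Let_def fl B_def norm_mult[symmetric] by simp
      also have "\<dots> \<le> w * cmod (B k t)"
        unfolding w_def by (intro mult_right_mono mult_mono z) auto
      finally show "cmod (block_term \<phi> f g N i j (of_int k + t)) \<le> w * cmod (B k t)" .
    qed
    then show "Lp_norm p3 torus (\<lambda>t. block_term \<phi> f g N i j (of_int k + t)) \<le> ennreal (w * C * (x k * y k))"
      by (simp add: mult_ac)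
    show "0 \<le> w * C * (x k * y k)" using w C x y by simp
  next
    show "0 \<le> w * C * (X * Y)" using w C XY by simp
    show "Lp_norm p3 (count_space UNIV) (\<lambda>k. complex_of_real (w * C * (x k * y k))) \<le> ennreal (w * C * (X * Y))"
      using w C XY x y by (intro Lp_norm_dominated[OF p3 _ _ _ _ _ count]) (auto simp: norm_mult)
  qed
  also have "w * C * (X * Y) \<le> tent_constant * C * nf * ng * (1 / 4) ^ (i + j)"
  proof -
    have e: "(4 * pi) ^ c / fact c \<le> exp (16 * pi) * (1 / 4) ^ c" for c
      using power_over_fact_le[of "4 * pi" c] by simp
    have "w * C * (X * Y) = ((4 * pi) ^ i / fact i * ((4 * pi) ^ j / fact j)) * ((10 * decay_mass)\<^sup>2 * (C * nf * ng))"
      by (simp add: w_def X_def Y_def power_mult_distrib power2_eq_square mult_ac)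
    also have "\<dots> \<le> (exp (16 * pi) * (1 / 4) ^ i * (exp (16 * pi) * (1 / 4) ^ j)) * ((10 * decay_mass)\<^sup>2 * (C * nf * ng))"
      using C by (intro mult_right_mono mult_mono e) (auto simp: nf_def ng_def)
    also have "\<dots> = tent_constant * C * nf * ng * (1 / 4) ^ (i + j)"
      by (simp add: tent_constant_def power_mult_distrib power_add power2_eq_square mult_ac)
    finally show ?thesis .
  qed
  finally show ?thesis by (simp add: nf_def ng_def ennreal_leI)
qed

text \<open>Summing the block terms bounds the truncated operators uniformly in \<open>N\<close>, and Fatou's lemma
  passes to the limit.\<close>

lemma tent_extension_bound_R:
  assumes h: "holder_related p1 p2 p3"
  obtains c :: real where "c > 0"
    "\<And>\<phi> C. bound_T p1 p2 p3 \<phi> C \<Longrightarrow> bound_R p1 p2 p3 (tent_extension \<phi>) (c * C)"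
proof -
  note p3 = holder_related_exponent(3)[OF h]
  have p: "p1 \<ge> 1" "p2 \<ge> 1" using holder_related_ge_1[OF h] by auto
  obtain Q :: real where Q: "Q > 0"
    "\<And>(M :: real measure) u v D. (\<And>a b. v a b \<in> borel_measurable M) \<Longrightarrow> u \<in> borel_measurable M \<Longrightarrow> D \<ge> 0 \<Longrightarrow>
      (\<And>x S. (\<And>a b :: nat. 2 ^ (a + b) * cmod (v a b x) \<le> S) \<Longrightarrow> cmod (u x) \<le> 4 * S) \<Longrightarrow>
      (\<And>a b. Lp_norm p3 M (v a b) \<le> ennreal (D * (1 / 4) ^ (a + b))) \<Longrightarrow>
      Lp_norm p3 M u \<le> ennreal (Q * D)"
    using Lp_norm_double_series[OF p3, where ?'a = real] by blast
  have tc: "tent_constant > 0" using decay_mass_pos by (simp add: tent_constant_def)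
  show thesis
  proof (rule that[of "Q * tent_constant"])
    fix \<phi> C assume b: "bound_T p1 p2 p3 \<phi> C"
    have C: "C \<ge> 0" using b by (simp add: bound_T_def)
    have \<phi>_le: "cmod (\<phi> (n, m)) \<le> C" for n m by (rule multiplier_bounded[OF h b])
    show "bound_R p1 p2 p3 (tent_extension \<phi>) (Q * tent_constant * C)"
      unfolding bound_R_def
    proof (intro conjI ballI)
      show "0 \<le> Q * tent_constant * C" using Q tc C by simp
      fix f g assume f: "f \<in> schwartz" and g: "g \<in> schwartz"
      define nf where "nf = enn2real (Lp_norm p1 lebesgue f)"
      define ng where "ng = enn2real (Lp_norm p2 lebesgue g)"
      have nf: "Lp_norm p1 lebesgue f = ennreal nf" "nf \<ge> 0"
        using Lp_norm_schwartz_finite[OF f p(1)] by (auto simp: nf_def)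
      have ng: "Lp_norm p2 lebesgue g = ennreal ng" "ng \<ge> 0"
        using Lp_norm_schwartz_finite[OF g p(2)] by (auto simp: ng_def)
      define D where "D = tent_constant * C * nf * ng"
      have D: "D \<ge> 0" using tc C nf ng by (simp add: D_def)
      have bt: "block_term \<phi> f g N i j \<in> borel_measurable lebesgue" for N i j
        using block_term_measurable[OF f g] by (intro measurable_completion) simp
      have um: "bilin_R (fejer_extension \<phi> N) f g \<in> borel_measurable lebesgue" for N
        by (rule borel_measurable_LIMSEQ_metric[OF _ bilin_R_fejer_extension_series[OF f g]])
           (intro borel_measurable_sum bt)
      have le: "Lp_norm p3 lebesgue (bilin_R (fejer_extension \<phi> (Suc N)) f g) \<le> ennreal (Q * D)" for N
      proof (rule Q(2)[OF bt um D])
        show "cmod (bilin_R (fejer_extension \<phi> (Suc N)) f g x) \<le> 4 * S"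
          if "\<And>a b. 2 ^ (a + b) * cmod (block_term \<phi> f g (Suc N) a b x) \<le> S" for x S
          using bilin_R_fejer_extension_series[OF f g] that by (rule norm_le_of_geometric_terms)
        show "Lp_norm p3 lebesgue (block_term \<phi> f g (Suc N) i j) \<le> ennreal (D * (1 / 4) ^ (i + j))" for i j
          using block_term_Lp_norm[OF h b f g zero_less_Suc] by (simp add: D_def nf_def ng_def)
      qed
      have lim: "(\<lambda>N. bilin_R (fejer_extension \<phi> (Suc N)) f g x) \<longlonglongrightarrow> bilin_R (tent_extension \<phi>) f g x" for x
        by (rule bilin_R_tendsto[OF f g fejer_extension_measurable fejer_extension_tendsto])
           (rule fejer_extension_bounded[where \<phi> = \<phi>, OF zero_less_Suc \<phi>_le])
      have "Lp_norm p3 lebesgue (bilin_R (tent_extension \<phi>) f g) \<le> ennreal (Q * D)"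
        by (rule Lp_norm_Fatou[where u = "\<lambda>N. bilin_R (fejer_extension \<phi> (Suc N)) f g", OF p3 um lim le])
           (use Q(1) D in simp)
      also have "\<dots> = ennreal (Q * tent_constant * C) * Lp_norm p1 lebesgue f * Lp_norm p2 lebesgue g"
        unfolding nf ng D_def using Q tc C nf ng by (simp add: mult.assoc flip: ennreal_mult)
      finally show "Lp_norm p3 lebesgue (bilin_R (tent_extension \<phi>) f g)
        \<le> ennreal (Q * tent_constant * C) * Lp_norm p1 lebesgue f * Lp_norm p2 lebesgue g" .
    qed
  qed (use Q tc in simp)
qed

theorem theorem4p4:
  fixes p1 p2 p3 :: ennreal
  assumes "holder_related p1 p2 p3" and "p3 > 1 / 2"
  shows "\<exists>c :: real. \<forall>\<phi> \<in> multipliers_T p1 p2 p3.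
           tent_extension \<phi> \<in> multipliers_R p1 p2 p3 \<and>
           multiplier_norm_R p1 p2 p3 (tent_extension \<phi>) \<le> c * multiplier_norm_T p1 p2 p3 \<phi>"
proof -
  obtain c :: real where c: "c > 0"
    "\<And>\<phi> C. bound_T p1 p2 p3 \<phi> C \<Longrightarrow> bound_R p1 p2 p3 (tent_extension \<phi>) (c * C)"
    using tent_extension_bound_R[OF assms(1)] by blast
  show ?thesis
  proof (intro exI[of _ c] ballI conjI)
    fix \<phi> assume "\<phi> \<in> multipliers_T p1 p2 p3"
    then obtain C where C: "bound_T p1 p2 p3 \<phi> C" by (auto simp: multipliers_T_def)
    have "tent_extension \<phi> \<in> L_infinity lebesgue"
      using multiplier_bounded[OF assms(1) C] by (rule tent_extension_L_infinity)
    then show "tent_extension \<phi> \<in> multipliers_R p1 p2 p3"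
      using c(2)[OF C] by (auto simp: multipliers_R_def)
    have bdd: "bdd_below {C. bound_R p1 p2 p3 (tent_extension \<phi>) C}"
      by (rule bdd_belowI[of _ 0]) (simp add: bound_R_def)
    have "multiplier_norm_R p1 p2 p3 (tent_extension \<phi>) / c \<le> multiplier_norm_T p1 p2 p3 \<phi>"
      unfolding multiplier_norm_T_def
    proof (rule cInf_greatest)
      show "{C. bound_T p1 p2 p3 \<phi> C} \<noteq> {}" using C by blast
      fix C' assume "C' \<in> {C. bound_T p1 p2 p3 \<phi> C}"
      then have "multiplier_norm_R p1 p2 p3 (tent_extension \<phi>) \<le> c * C'"
        unfolding multiplier_norm_R_def using c(2) by (intro cInf_lower bdd) simp
      then show "multiplier_norm_R p1 p2 p3 (tent_extension \<phi>) / c \<le> C'"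
        using c(1) by (simp add: field_simps)
    qed
    then show "multiplier_norm_R p1 p2 p3 (tent_extension \<phi>) \<le> c * multiplier_norm_T p1 p2 p3 \<phi>"
      using c(1) by (simp add: field_simps)
  qed
qed

end
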